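(* Let $0<q<1$ and $\phi(z)=\sum_{n\geq1}\phi_nz^n$ with real coefficients such that: (i) $\phi_i\geq0$ for all $i\geq1$; (ii) $\min\{x>0:\phi(x)=1\}$ exists and equals $1$; (iii) for every integer $j\geq0$, $\lim_{n\to\infty}\phi_{j+n}/\phi_n$ exists in $[0,\infty)$; (iv) $\bigl([z^n]\frac1{1-\phi(z)}\bigr)_{n\ge0}$ is regularly varying with index $\rho-1\in(-1,0]$. Let $f(z)=z(1-\phi(z))=\sum f_nz^n$, let $g=\sum g_nz^n$ be the formal power series with $g_0=0$ solving $\sum_{n\geq 1} f_n\, g(z)g(z/q)\cdots g(z/q^{n-1})=z$, and set $t_n=q^{\binom{n+1}2}g_{n+1}$ (a polynomial in $q$), $\Phi_n=\Gamma(\rho)\bigl(1-\phi(1-1/n)\bigr)$ and $L(q)=1/\prod_{j\geq1}(1-\phi(q^j))$. Then: (i) $\liminf_{n\to\infty}n\Phi_nt_n=L(q)$; (ii) the sequence $(n\Phi_nt_n)_{n\geq0}$ converges to $L(q)$ except possibly on a set of integers of density $0$, i.e. for every $\delta>0$, $\frac1n\#\{1\le i\le n:|i\Phi_it_i-L(q)|\ge\delta\}\to0$; (iii) for every $j\geq0$, $\lim_{n\to\infty}n\Phi_n[q^j]t_n=[q^j]L(q)$.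
   Context: A sequence $(a_n)$ is regularly varying with index $\alpha$ if $\lim_{t\to\infty}a_{\lfloor\lambda t\rfloor}/a_{\lfloor t\rfloor}=\lambda^\alpha$ for every $\lambda>0$. Equivalently, $(t_n)$ is defined by $\sum_{n\ge0}t_nq^{-\binom{n+1}2}f(z)f(qz)\cdots f(q^nz)=z$. $[q^j]$ denotes the coefficient of $q^j$ ($L(q)$ viewed as power series in $q$). *)

theory Defs
  imports "HOL-Analysis.Analysis"
begin

definition regularly_varying_seq :: "(nat \<Rightarrow> real) \<Rightarrow> real \<Rightarrow> bool" where
  "regularly_varying_seq a \<alpha> \<longleftrightarrow>
     (\<forall>lam>0. ((\<lambda>t::real. a (nat \<lfloor>lam * t\<rfloor>) / a (nat \<lfloor>t\<rfloor>)) \<longlongrightarrow> lam powr \<alpha>) at_top)"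

text \<open>
  For a fixed number \<open>q\<close>, the power series \<open>g\<close> with \<open>g(0) = 0\<close> solves
  \<open>f\<^sub>1 g(z) + f\<^sub>2 g(z) g(z/q) + f\<^sub>3 g(z) g(z/q) g(z/q\<^sup>2) + \<dots> = z\<close>.
  The series converges in the topology of formal power series, since its \<open>n\<close>-th term is
  divisible by \<open>z\<^sup>n\<close>.
\<close>

definition q_lagrange_inverse :: "real \<Rightarrow> real fps \<Rightarrow> real fps \<Rightarrow> bool" where
  "q_lagrange_inverse q f g \<longleftrightarrow>
     fps_nth g 0 = 0 \<and>
     (\<lambda>n. fps_const (fps_nth f (Suc n)) *
           (\<Prod>i<Suc n. fps_compose g (fps_const (1 / q ^ i) * fps_X))) sums fps_X"

text \<open>\<open>g\<close> is a family of power series indexed by \<open>q\<close>, so that \<open>t\<^sub>n\<close> is a function of \<open>q\<close>.\<close>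

definition t_seq :: "(real \<Rightarrow> real fps) \<Rightarrow> nat \<Rightarrow> real \<Rightarrow> real" where
  "t_seq g n q = q ^ (Suc n choose 2) * fps_nth (g q) (Suc n)"

definition Phi_seq :: "real fps \<Rightarrow> real \<Rightarrow> nat \<Rightarrow> real" where
  "Phi_seq \<phi> \<rho> n = Gamma \<rho> * (1 - eval_fps \<phi> (1 - 1 / real n))"

definition L_val :: "real fps \<Rightarrow> real \<Rightarrow> real" where
  "L_val \<phi> q = 1 / (\<Prod>j. 1 - eval_fps \<phi> (q ^ Suc j))"

text \<open>The same expression in an indeterminate \<open>q\<close>; the infinite product is the one in the topology
  of formal power series.\<close>

definition L_fps :: "real fps \<Rightarrow> real fps" where
  "L_fps \<phi> = inverse (\<Prod>j. 1 - fps_compose \<phi> (fps_X ^ Suc j))"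

text \<open>If \<open>f\<^sub>1 \<noteq> 0\<close>, then \<^const>\<open>q_lagrange_inverse\<close> determines a unique
  power series, as the rest of this theory shows.\<close>

definition q_prod :: "real \<Rightarrow> real fps \<Rightarrow> nat \<Rightarrow> real fps" where
  "q_prod q g n = (\<Prod>i<n. fps_compose g (fps_const (1 / q ^ i) * fps_X))"

lemma q_prod_nth_less:
  assumes "fps_nth g 0 = 0" "k < n"
  shows "fps_nth (q_prod q g n) k = 0"
  using assms(2)
proof (induction n arbitrary: k)
  case (Suc n)
  have "fps_nth (q_prod q g n) i *
          fps_nth (fps_compose g (fps_const (1 / q ^ n) * fps_X)) (k - i) = 0"
    if "i \<in> {0..k}" for i
  proof (cases "i = k")
    case True
    then show ?thesis using assms(1) by (simp add: fps_compose_linear)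
  next
    case False
    then show ?thesis using Suc that by simp
  qed
  moreover have "q_prod q g (Suc n) =
      q_prod q g n * fps_compose g (fps_const (1 / q ^ n) * fps_X)"
    by (simp add: q_prod_def)
  ultimately show ?case by (simp only: fps_mult_nth) (rule sum.neutral, blast)
qed simp

lemma q_prod_nth_cong:
  assumes g: "fps_nth g 0 = 0" and h: "fps_nth h 0 = 0"
    and eq: "\<And>k. k \<le> m \<Longrightarrow> fps_nth g k = fps_nth h k"
    and k: "k \<le> (if n = 0 then m else Suc m)"
  shows "fps_nth (q_prod q g (Suc n)) k = fps_nth (q_prod q h (Suc n)) k"
  using k
proof (induction n arbitrary: k)
  case 0
  then show ?case using eq by (simp add: q_prod_def fps_compose_linear)
next
  case (Suc n)
  have "fps_nth (q_prod q g (Suc n)) i *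
          fps_nth (fps_compose g (fps_const (1 / q ^ Suc n) * fps_X)) (k - i) =
        fps_nth (q_prod q h (Suc n)) i *
          fps_nth (fps_compose h (fps_const (1 / q ^ Suc n) * fps_X)) (k - i)"
    if i: "i \<in> {0..k}" for i
  proof -
    consider "i = 0" | "i = k" | "0 < i" "i < k" using i by fastforce
    then show ?thesis
    proof cases
      case 1
      then show ?thesis using g h by (simp add: q_prod_nth_less)
    next
      case 2
      then show ?thesis using g h by (simp add: fps_compose_linear)
    next
      case 3
      then have "i \<le> m" "k - i \<le> m" using Suc.prems by auto
      then show ?thesis using Suc.IH[of i] eq[of "k - i"]
        by (simp add: fps_compose_linear)
    qed
  qed
  moreover have "q_prod q w (Suc (Suc n)) =
      q_prod q w (Suc n) * fps_compose w (fps_const (1 / q ^ Suc n) * fps_X)" for w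
    by (simp add: q_prod_def)
  ultimately show ?case by (simp only: fps_mult_nth) (rule sum.cong[OF refl], blast)
qed

definition q_step :: "real \<Rightarrow> real fps \<Rightarrow> real fps \<Rightarrow> real fps" where
  "q_step q f h = Abs_fps (\<lambda>k. (fps_nth fps_X k -
      (\<Sum>n\<in>{1..<k}. fps_nth f (Suc n) * fps_nth (q_prod q h (Suc n)) k)) / fps_nth f 1)"

lemma fps_sums_iff:
  fixes A :: "nat \<Rightarrow> real fps"
  assumes "\<And>n k. k \<le> n \<Longrightarrow> fps_nth (A n) k = 0"
  shows "A sums S \<longleftrightarrow> (\<forall>k. (\<Sum>n<k. fps_nth (A n) k) = fps_nth S k)"
proof -
  have *: "(\<Sum>n<N. fps_nth (A n) k) = (\<Sum>n<k. fps_nth (A n) k)" if "N \<ge> k" for N k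
    by (rule sum.mono_neutral_right) (use that assms in auto)
  have "A sums S \<longleftrightarrow> (\<forall>k. \<forall>\<^sub>F N in sequentially. (\<Sum>n<N. fps_nth (A n) k) = fps_nth S k)"
    unfolding sums_def tendsto_fps_iff by (simp add: fps_sum_nth)
  also have "\<dots> \<longleftrightarrow> (\<forall>k. (\<Sum>n<k. fps_nth (A n) k) = fps_nth S k)"
  proof (intro iff_allI iffI)
    fix k assume "\<forall>\<^sub>F N in sequentially. (\<Sum>n<N. fps_nth (A n) k) = fps_nth S k"
    then obtain N0 where "\<forall>N\<ge>N0. (\<Sum>n<N. fps_nth (A n) k) = fps_nth S k"
      by (auto simp: eventually_sequentially)
    then show "(\<Sum>n<k. fps_nth (A n) k) = fps_nth S k"
      using *[of k "max N0 k"] by simp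
  next
    fix k assume S: "(\<Sum>n<k. fps_nth (A n) k) = fps_nth S k"
    have "(\<Sum>n<N. fps_nth (A n) k) = fps_nth S k" if "N \<ge> k" for N
      using *[OF that] S by (rule trans)
    then show "\<forall>\<^sub>F N in sequentially. (\<Sum>n<N. fps_nth (A n) k) = fps_nth S k"
      by (rule eventually_sequentiallyI)
  qed
  finally show ?thesis .
qed

lemma q_lagrange_inverse_iff_fixpoint:
  assumes f1: "fps_nth f 1 \<noteq> 0"
  shows "q_lagrange_inverse q f g \<longleftrightarrow> fps_nth g 0 = 0 \<and> q_step q f g = g"
proof (cases "fps_nth g 0 = 0")
  case g: True
  have "q_lagrange_inverse q f g \<longleftrightarrow>
      (\<lambda>n. fps_const (fps_nth f (Suc n)) * q_prod q g (Suc n)) sums fps_X"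
    using g unfolding q_lagrange_inverse_def q_prod_def by simp
  also have "\<dots> \<longleftrightarrow> (\<forall>k. (\<Sum>n<k. fps_nth f (Suc n) * fps_nth (q_prod q g (Suc n)) k) =
      fps_nth fps_X k)"
    by (subst fps_sums_iff) (simp_all add: q_prod_nth_less[OF g])
  also have "\<dots> \<longleftrightarrow> (\<forall>k. fps_nth (q_step q f g) k = fps_nth g k)"
  proof (rule iff_allI)
    fix k
    show "(\<Sum>n<k. fps_nth f (Suc n) * fps_nth (q_prod q g (Suc n)) k) = fps_nth fps_X k
      \<longleftrightarrow> fps_nth (q_step q f g) k = fps_nth g k"
    proof (cases k)
      case 0
      then show ?thesis using g by (simp add: q_step_def)
    next
      case (Suc l)
      have "{..<k} = insert 0 {1..<k}" using Suc by auto
      moreover have "q_prod q g (Suc 0) = g"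
        by (simp add: q_prod_def)
      ultimately have sum_eq: "(\<Sum>n<k. fps_nth f (Suc n) * fps_nth (q_prod q g (Suc n)) k) =
          fps_nth f 1 * fps_nth g k +
          (\<Sum>n\<in>{1..<k}. fps_nth f (Suc n) * fps_nth (q_prod q g (Suc n)) k)"
        by simp
      have "c * x + S = X \<longleftrightarrow> (X - S) / c = x" if "c \<noteq> 0" for c x S X :: real
        using that by (auto simp: field_simps)
      from this[OF f1] show ?thesis unfolding q_step_def fps_nth_Abs_fps sum_eq .
    qed
  qed
  finally show ?thesis using g by (simp add: fps_eq_iff)
next
  case False
  then show ?thesis unfolding q_lagrange_inverse_def by blast
qed

lemma q_step_cong:
  assumes "fps_nth g 0 = 0" "fps_nth h 0 = 0" "\<And>k. k \<le> m \<Longrightarrow> fps_nth g k = fps_nth h k"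
    and "k \<le> Suc m"
  shows "fps_nth (q_step q f g) k = fps_nth (q_step q f h) k"
proof -
  have eq: "fps_nth f (Suc n) * fps_nth (q_prod q g (Suc n)) k =
      fps_nth f (Suc n) * fps_nth (q_prod q h (Suc n)) k" if "n \<in> {1..<k}" for n
  proof -
    have "k \<le> (if n = 0 then m else Suc m)"
      using that assms(4) by simp
    from q_prod_nth_cong[OF assms(1-3) this] show ?thesis by (simp only:)
  qed
  have "(\<Sum>n\<in>{1..<k}. fps_nth f (Suc n) * fps_nth (q_prod q g (Suc n)) k) =
      (\<Sum>n\<in>{1..<k}. fps_nth f (Suc n) * fps_nth (q_prod q h (Suc n)) k)"
    using eq by (rule sum.cong[OF refl])
  then show ?thesis unfolding q_step_def fps_nth_Abs_fps by (simp only:)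
qed

theorem q_lagrange_inverse_ex1:
  assumes f1: "fps_nth f 1 \<noteq> 0"
  shows "\<exists>!g. q_lagrange_inverse q f g"
proof -
  define h where "h m = (q_step q f ^^ m) 0" for m
  have h0: "fps_nth (h m) 0 = 0" for m
    by (cases m) (simp_all add: h_def q_step_def)
  have hS: "h (Suc m) = q_step q f (h m)" for m
    by (simp add: h_def)
  have h_stable: "fps_nth (h (Suc m)) k = fps_nth (h m) k" if "k \<le> m" for m k
    using that
  proof (induction m arbitrary: k)
    case 0
    then show ?case by (simp add: h0)
  next
    case (Suc m)
    have "fps_nth (q_step q f (h (Suc m))) k = fps_nth (q_step q f (h m)) k"
      by (rule q_step_cong[where m = m]) (simp_all only: h0 Suc)
    then show ?case by (simp only: hS)
  qed
  define g where "g = Abs_fps (\<lambda>k. fps_nth (h k) k)"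
  have g0: "fps_nth g 0 = 0" by (simp add: g_def h0)
  have gh: "fps_nth g k = fps_nth (h m) k" if "k \<le> m" for k m
    using that by (induction m rule: dec_induct) (auto simp: g_def h_stable)
  have "q_step q f g = g"
  proof (rule fps_ext)
    fix k
    have "fps_nth (q_step q f g) k = fps_nth (q_step q f (h k)) k"
      by (rule q_step_cong[where m = k]) (use g0 h0 gh in auto)
    also have "\<dots> = fps_nth g k" using gh[of k "Suc k"] by (simp add: hS)
    finally show "fps_nth (q_step q f g) k = fps_nth g k" .
  qed
  moreover have "u = v"
    if "fps_nth u 0 = 0" "q_step q f u = u" "fps_nth v 0 = 0" "q_step q f v = v" for u v
  proof (rule fps_ext)
    have "\<forall>k\<le>m. fps_nth u k = fps_nth v k" for m
    proof (induction m)
      case 0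
      show ?case using that(1,3) by (metis le_zero_eq)
    next
      case (Suc m)
      have "fps_nth (q_step q f u) k = fps_nth (q_step q f v) k" if "k \<le> Suc m" for k
        using Suc \<open>k \<le> Suc m\<close>
        by (intro q_step_cong[OF \<open>fps_nth u 0 = 0\<close> \<open>fps_nth v 0 = 0\<close>, of m]) blast+
      then show ?case unfolding \<open>q_step q f u = u\<close> \<open>q_step q f v = v\<close> by blast
    qed
    then show "fps_nth u k = fps_nth v k" for k by blast
  qed
  ultimately show ?thesis
    unfolding q_lagrange_inverse_iff_fixpoint[OF f1] using g0 by (intro ex1I[of _ g]) blast+
qed

end

theory Submission
  imports Defs "HOL-Computational_Algebra.Polynomial_FPS" "HOL-Real_Asymp.Real_Asymp"
begin

text \<open>
  Let \<open>F = 1 - \<phi>\<close> and \<open>1/F = \<Sum> u\<^sub>n z\<^sup>n\<close>. By Garsia's duality,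
  \<open>\<Sum> t\<^sub>n z\<^sup>n F(z) F(qz) \<dots> F(q\<^sup>n z) = 1\<close>. Multiplying by
  \<open>W(z) = \<Prod>\<^sub>i 1/F(q\<^sup>i z) = \<Sum> w\<^sub>n z\<^sup>n\<close> turns this into
  \<open>\<Sum>\<^sub>k t\<^sub>k q^((k+1)(n-k)) w\<^sub>n\<^sub>-\<^sub>k = w\<^sub>n\<close>. Every term with \<open>k < n\<close> carries a factor
  \<open>q\<^sup>n\<close>, hence \<open>t\<^sub>n\<close> agrees with \<open>w\<^sub>n\<close> up to a negligible error, for a number \<open>q\<close> as well as
  coefficientwise for an indeterminate \<open>q\<close>. From \<open>W(z) = W(qz)/F(z)\<close> and \<open>u\<^sub>n\<^sub>-\<^sub>m/u\<^sub>n \<rightarrow> 1\<close> one gets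
  \<open>w\<^sub>n/u\<^sub>n \<rightarrow> W(q) = L(q)\<close>. Karamata's theorem gives \<open>n \<Phi>\<^sub>n u\<^sub>n \<rightarrow> 1\<close>, so the whole sequence
  \<open>n \<Phi>\<^sub>n t\<^sub>n\<close> converges to \<open>L(q)\<close>, which is stronger than (i) and (ii).
\<close>

subsection \<open>Duality\<close>

text \<open>The numerical limits and the coefficientwise one concern the same recursion over
  different coefficient rings: the reals for a number q, polynomials for the witness
  \<open>T\<close>, power series for an indeterminate q. Hence the algebra is done over an arbitrary
  commutative ring, where only units such as 1 - q^n may be divided by, and homomorphisms pass
  between the rings. For the same reason W is taken as the solution of F(z) W(z) = W(qz) with W(0) =
  1; the infinite product is recovered from it only at z = q. For a number q the factor q^n is not
  enough by itself: a priori the t_k could grow and u_n could decay fast. The first is excluded by a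
  discrete Gronwall inequality, the second by Potter bounds. These bounds also dominate u_(n-m)/u_n
  in the series for w_n/u_n, and the integrand in Karamata's theorem, since regular variation gives
  each limit only for one fixed lambda at a time.\<close>

definition fps_dilate :: "'a::comm_ring_1 \<Rightarrow> 'a fps \<Rightarrow> 'a fps" where
  "fps_dilate c F = Abs_fps (\<lambda>n. c ^ n * fps_nth F n)"

lemma fps_dilate_nth [simp]: "fps_nth (fps_dilate c F) n = c ^ n * fps_nth F n"
  by (simp add: fps_dilate_def)

lemma fps_dilate_mult: "fps_dilate c (F * G) = fps_dilate c F * fps_dilate c G"
proof (rule fps_ext)
  fix n
  have "c ^ n * (fps_nth F i * fps_nth G (n - i)) =
      c ^ i * fps_nth F i * (c ^ (n - i) * fps_nth G (n - i))" if "i \<in> {0..n}" for i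
  proof -
    have "c ^ n = c ^ i * c ^ (n - i)" using that by (simp flip: power_add)
    then show ?thesis by (simp add: mult_ac)
  qed
  then show "fps_nth (fps_dilate c (F * G)) n = fps_nth (fps_dilate c F * fps_dilate c G) n"
    by (simp add: fps_mult_nth sum_distrib_left)
qed

lemma fps_dilate_1 [simp]: "fps_dilate 1 F = F"
  by (rule fps_ext) simp

lemma fps_dilate_one [simp]: "fps_dilate c 1 = 1"
  by (rule fps_ext) simp

lemma fps_dilate_dilate: "fps_dilate c (fps_dilate d F) = fps_dilate (c * d) F"
  by (rule fps_ext) (simp add: power_mult_distrib mult_ac)

definition qpoch :: "'a::comm_ring_1 fps \<Rightarrow> 'a \<Rightarrow> nat \<Rightarrow> 'a fps" where
  "qpoch F q n = (\<Prod>i<n. fps_dilate (q ^ i) F)"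

lemma qpoch_0 [simp]: "qpoch F q 0 = 1"
  by (simp add: qpoch_def)

lemma qpoch_Suc: "qpoch F q (Suc n) = qpoch F q n * fps_dilate (q ^ n) F"
  by (simp add: qpoch_def)

lemma qpoch_add: "qpoch F q (m + n) = qpoch F q m * fps_dilate (q ^ m) (qpoch F q n)"
  by (induction n) (simp_all add: qpoch_Suc fps_dilate_mult fps_dilate_dilate power_add mult.assoc)

lemma qpoch_nth_0: "fps_nth F 0 = 1 \<Longrightarrow> fps_nth (qpoch F q n) 0 = 1"
  by (induction n) (simp_all add: qpoch_Suc)

lemma qpoch_nth_less: "fps_nth F 0 = 0 \<Longrightarrow> k < n \<Longrightarrow> fps_nth (qpoch F q n) k = 0"
proof (induction n arbitrary: k)
  case (Suc n)
  have "fps_nth (qpoch F q n) i * fps_nth (fps_dilate (q ^ n) F) (k - i) = 0" if "i \<in> {0..k}" for i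
    using that Suc by (cases "i = k") auto
  then show ?case unfolding qpoch_Suc fps_mult_nth by (rule sum.neutral[rule_format])
qed simp

text \<open>Telescoping: the factor F(q^i z) moves W(q^i z) on to W(q^(i+1) z).\<close>

lemma qpoch_mult_fixed:
  assumes "F * W = fps_dilate q W"
  shows "qpoch F q n * W = fps_dilate (q ^ n) W"
proof (induction n)
  case (Suc n)
  have "qpoch F q (Suc n) * W = fps_dilate (q ^ n) F * (qpoch F q n * W)"
    by (simp add: qpoch_Suc mult_ac)
  also have "\<dots> = fps_dilate (q ^ n) (F * W)"
    by (simp add: Suc fps_dilate_mult)
  finally show ?case by (simp add: assms fps_dilate_dilate mult_ac)
qed simp

text \<open>Origin of the power of q in \<open>t_seq\<close>: for f = z F(z), the factors q^i z with
  i < n contribute q^(0 + 1 + ... + (n-1)) z^n.\<close>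

lemma qpoch_fps_X_mult:
  "qpoch (fps_X * F) q n = fps_const (q ^ (n choose 2)) * fps_X ^ n * qpoch F q n"
proof (induction n)
  case (Suc n)
  have X: "fps_dilate c fps_X = fps_const c * fps_X" for c :: 'a
    by (rule fps_ext) (simp add: fps_X_def)
  have "Suc n choose 2 = (n choose 2) + n"
    by (simp add: numeral_2_eq_2)
  then have "fps_const (q ^ (Suc n choose 2)) = fps_const (q ^ (n choose 2)) * fps_const (q ^ n)"
    by (simp add: power_add)
  then show ?case
    unfolding qpoch_Suc Suc.IH fps_dilate_mult X power_Suc by (simp only: mult_ac)
qed (simp add: numeral_2_eq_2)

text \<open>The numbers \<open>t\<^sub>n\<close> with \<open>\<Sum>\<^sub>n t\<^sub>n z\<^sup>n F(z) F(qz) \<dots> F(q\<^sup>nz) = 1\<close>,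
  for \<open>F(0) = 1\<close>.\<close>

fun qcoef :: "'a::comm_ring_1 fps \<Rightarrow> 'a \<Rightarrow> nat \<Rightarrow> 'a" where
  "qcoef F q n = (if n = 0 then 1 else
     - (\<Sum>k<n. qcoef F q k * fps_nth (qpoch F q (Suc k)) (n - k)))"

declare qcoef.simps [simp del]

text \<open>The system is triangular with diagonal entries F(0)^(k+1) = 1, so it determines its
  solution without any division. This identifies both \<open>t_seq\<close> and homomorphic images
  with \<open>qcoef\<close>.\<close>

lemma qcoef_unique:
  assumes F: "fps_nth F 0 = 1"
  assumes s: "\<And>n. (\<Sum>k\<le>n. s k * fps_nth (qpoch F q (Suc k)) (n - k)) = of_bool (n = 0)"
  shows "s n = qcoef F q n"
proof (induction n rule: less_induct)
  case (less n)
  have "s n + (\<Sum>k<n. s k * fps_nth (qpoch F q (Suc k)) (n - k)) = of_bool (n = 0)"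
    using s[of n] F by (simp add: lessThan_Suc_atMost[symmetric] qpoch_nth_0 add.commute)
  moreover have "(\<Sum>k<n. s k * fps_nth (qpoch F q (Suc k)) (n - k)) =
      (\<Sum>k<n. qcoef F q k * fps_nth (qpoch F q (Suc k)) (n - k))"
    by (rule sum.cong) (simp_all add: less)
  ultimately show ?case
    by (subst qcoef.simps) (auto simp: eq_neg_iff_add_eq_0)
qed

lemma qcoef_sum:
  assumes F: "fps_nth F 0 = 1"
  shows "(\<Sum>k\<le>n. qcoef F q k * fps_nth (qpoch F q (Suc k)) (n - k)) = of_bool (n = 0)"
  using F by (subst lessThan_Suc_atMost[symmetric])
    (simp add: qpoch_nth_0 qcoef.simps[of F q n])

text \<open>A homomorphism maps the defining system to the system of the image, where uniqueness
  applies. It serves for evaluation of polynomials at a number and for their embedding into power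
  series.\<close>

lemma qcoef_hom:
  fixes h :: "'a::comm_ring_1 \<Rightarrow> 'b::comm_ring_1"
  assumes F: "fps_nth F 0 = 1"
    and add: "\<And>x y. h (x + y) = h x + h y" and mult: "\<And>x y. h (x * y) = h x * h y"
    and one: "h 1 = 1"
  shows "h (qcoef F q n) = qcoef (Abs_fps (\<lambda>n. h (fps_nth F n))) (h q) n"
proof -
  have zero: "h 0 = 0" using add[of 0 0] by simp
  have hsum: "h (sum f A) = (\<Sum>x\<in>A. h (f x))" for f and A :: "nat set"
    by (induction A rule: infinite_finite_induct) (simp_all add: zero add)
  have hpow: "h (x ^ k) = h x ^ k" for x k
    by (induction k) (simp_all add: one mult)
  define H where "H G = Abs_fps (\<lambda>n. h (fps_nth G n))" for G
  have H_mult: "H (G * G') = H G * H G'" for G G'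
    by (rule fps_ext) (simp add: H_def fps_mult_nth hsum mult)
  have H_dilate: "H (fps_dilate c G) = fps_dilate (h c) (H G)" for c G
    by (rule fps_ext) (simp add: H_def mult hpow)
  have H_one: "H 1 = 1"
    by (rule fps_ext) (simp add: H_def one zero)
  have H_qpoch: "H (qpoch F q k) = qpoch (H F) (h q) k" for k
    by (induction k) (simp_all add: qpoch_Suc H_mult H_dilate H_one hpow)
  have "h (qcoef F q n) = qcoef (H F) (h q) n"
  proof (rule qcoef_unique)
    fix n
    have "(\<Sum>k\<le>n. h (qcoef F q k) * fps_nth (H (qpoch F q (Suc k))) (n - k)) =
        h (of_bool (n = 0))"
      unfolding qcoef_sum[OF F, of q n, symmetric] by (simp add: H_def hsum mult)
    then show "(\<Sum>k\<le>n. h (qcoef F q k) * fps_nth (qpoch (H F) (h q) (Suc k)) (n - k)) =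
        of_bool (n = 0)"
      unfolding H_qpoch by (simp add: one zero)
  qed (simp add: H_def F one)
  then show ?thesis by (simp add: H_def)
qed

lemma qcoef_fixed_sum:
  assumes F: "fps_nth F 0 = 1" and W: "F * W = fps_dilate q W"
  shows "(\<Sum>k\<le>n. qcoef F q k * q ^ (Suc k * (n - k)) * fps_nth W (n - k)) = fps_nth W n"
proof -
  \<comment> \<open>Cutting the generating identity off at k = n leaves its coefficients up to z^n
    unchanged, and the n-th coefficient of \<open>S * W\<close> sees no others.\<close>
  define S where "S = (\<Sum>k\<le>n. fps_const (qcoef F q k) * (fps_X ^ k * qpoch F q (Suc k)))"
  have S_nth: "fps_nth S a = of_bool (a = 0)" if "a \<le> n" for a
  proof -
    have "fps_nth S a = (\<Sum>k\<le>n. if k \<le> a then qcoef F q k * fps_nth (qpoch F q (Suc k)) (a - k) else 0)"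
      unfolding S_def fps_sum_nth
      by (intro sum.cong) (auto simp: fps_X_power_mult_nth)
    also have "\<dots> = (\<Sum>k\<le>a. qcoef F q k * fps_nth (qpoch F q (Suc k)) (a - k))"
      using that by (intro sum.mono_neutral_cong_right) auto
    finally show ?thesis using qcoef_sum[OF F, of q a] by simp
  qed
  have "fps_nth (S * W) n = (\<Sum>i=0..n. of_bool (i = 0) * fps_nth W (n - i))"
    unfolding fps_mult_nth by (intro sum.cong) (simp_all add: S_nth)
  also have "\<dots> = fps_nth W n"
    by (simp add: sum.atLeast_Suc_atMost)
  finally have "fps_nth W n = fps_nth (S * W) n" ..
  also have "S * W = (\<Sum>k\<le>n. fps_const (qcoef F q k) * (fps_X ^ k * fps_dilate (q ^ Suc k) W))"
    unfolding S_def sum_distrib_right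
    by (simp add: mult.assoc qpoch_mult_fixed[OF W] del: power_Suc)
  also have "fps_nth \<dots> n = (\<Sum>k\<le>n. qcoef F q k * q ^ (Suc k * (n - k)) * fps_nth W (n - k))"
    unfolding fps_sum_nth
    by (intro sum.cong)
      (simp_all add: fps_X_power_mult_nth mult.assoc power_mult[symmetric] del: power_Suc mult_Suc)
  finally show ?thesis ..
qed

text \<open>Comparing coefficients of z^n in F(z) W(z) = W(qz) gives (1 - q^n) w_n = - (sum of w_m
  F_(n-m) over m < n). Here \<open>v n\<close> stands for an inverse of 1 - q^n, so that the
  recursion also runs in rings that are not fields.\<close>

fun qfix :: "(nat \<Rightarrow> 'a) \<Rightarrow> 'a::comm_ring_1 fps \<Rightarrow> nat \<Rightarrow> 'a" where
  "qfix v F n = (if n = 0 then 1 else - v n * (\<Sum>m<n. qfix v F m * fps_nth F (n - m)))"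

declare qfix.simps [simp del]

text \<open>Here \<open>W(z) = 1 / (F(z) F(qz) F(q\<^sup>2z) \<dots>)\<close>.\<close>

lemma qfix_exists:
  fixes F :: "'a::comm_ring_1 fps"
  assumes F: "fps_nth F 0 = 1" and unit: "\<And>n. n \<ge> 1 \<Longrightarrow> \<exists>v. v * (1 - q ^ n) = 1"
  obtains W where "fps_nth W 0 = 1" "F * W = fps_dilate q W"
proof -
  obtain v where v: "\<And>n. n \<ge> 1 \<Longrightarrow> v n * (1 - q ^ n) = 1"
    using unit by metis
  define W where "W = Abs_fps (qfix v F)"
  have W0: "fps_nth W 0 = 1" by (simp add: W_def qfix.simps)
  have "fps_nth (W * F) n = q ^ n * fps_nth W n" for n
  proof (cases "n = 0")
    case False
    define S where "S = (\<Sum>m<n. fps_nth W m * fps_nth F (n - m))"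
    have "fps_nth W n = - v n * S"
      using False by (simp add: W_def S_def qfix.simps[of v F n])
    then have "(1 - q ^ n) * fps_nth W n = - (v n * (1 - q ^ n)) * S"
      by (simp add: mult_ac)
    also have "\<dots> = - S" using v False by simp
    finally have "fps_nth W n + S = q ^ n * fps_nth W n"
      by (simp add: algebra_simps eq_neg_iff_add_eq_0)
    moreover have "fps_nth (W * F) n = fps_nth W n + S"
      unfolding fps_mult_nth S_def
      by (simp add: atLeast0AtMost lessThan_Suc_atMost[symmetric] F)
    ultimately show ?thesis by simp
  qed (simp add: W0 F)
  then have "F * W = fps_dilate q W"
    by (intro fps_ext) (simp add: mult.commute)
  with W0 show ?thesis by (rule that)
qed

section \<open>Garsia's duality by mutually inverse triangular matrices\<close>

lemma sum_triangle:
  fixes h :: "nat \<Rightarrow> nat \<Rightarrow> 'a::comm_monoid_add"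
  assumes "\<And>i j. k < i + j \<Longrightarrow> h i j = 0"
  shows "(\<Sum>n\<le>k. \<Sum>i\<le>n. h i (n - i)) = (\<Sum>i\<le>k. \<Sum>j\<le>k. h i j)"
proof -
  have "(\<Sum>n\<le>k. \<Sum>i\<le>n. h i (n - i)) = (\<Sum>(i, j)\<in>{(i, j). i + j \<le> k}. h i j)"
    by (rule sum.triangle_reindex_eq[symmetric])
  also have "\<dots> = (\<Sum>(i, j)\<in>{..k} \<times> {..k}. h i j)"
    by (rule sum.mono_neutral_left) (use assms in \<open>auto simp flip: not_less\<close>)
  finally show ?thesis by (simp add: sum.cartesian_product)
qed

text \<open>The linear operators sending \<open>z\<^sup>m\<close> to \<open>qpoch f r m\<close> and to \<open>qpoch g s m\<close> are inverse to
  each other. Writing \<open>U\<close> for the second one, \<open>U(z\<^sup>i h(z)) = qpoch g s i (z) (U h)(s\<^sup>i z)\<close>, so that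
  \<open>U h = z\<^sup>m\<close> implies \<open>U(f(r\<^sup>m z) h(z)) = z\<^sup>m\<^sup>+\<^sup>1\<close>.\<close>

lemma qpoch_inverse:
  fixes f g :: "'a::comm_ring_1 fps"
  assumes rs: "r * s = 1" and f0: "fps_nth f 0 = 0" and g0: "fps_nth g 0 = 0"
    and fg: "\<And>k. (\<Sum>n\<le>k. fps_nth f n * fps_nth (qpoch g s n) k) = of_bool (k = 1)"
  shows "(\<Sum>n\<le>k. fps_nth (qpoch g s n) k * fps_nth (qpoch f r m) n) = of_bool (k = m)"
proof (induction m arbitrary: k)
  case 0
  show ?case by (simp add: sum.atMost_shift[of _ k])
next
  case (Suc m)
  define A where "A k n = fps_nth (qpoch g s n) k" for k n
  define B where "B n m = fps_nth (qpoch f r m) n" for n m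
  have A0: "A k n = 0" if "k < n" for k n
    using qpoch_nth_less[OF g0 that] by (simp add: A_def)
  \<comment> \<open>The product is split in the order j + i, so that the dilation by s^j falls on
    the factor with index i. Summing over i first then meets the induction hypothesis, which leaves
    only a = k - m.\<close>
  have A_add: "A k (i + j) = (\<Sum>a\<le>k. A a j * (s ^ (j * (k - a)) * A (k - a) i))" for i j
    unfolding A_def add.commute[of i j] qpoch_add fps_mult_nth fps_dilate_nth
    by (simp add: atLeast0AtMost power_mult)
  have ext: "(\<Sum>n\<le>k. A b n * c n) = (\<Sum>n\<le>b. A b n * c n)" if "b \<le> k" for b c
    using that by (intro sum.mono_neutral_right) (auto simp: A0)
  have swap3: "(\<Sum>i\<le>k. \<Sum>j\<le>k. \<Sum>a\<le>k. h i j a) = (\<Sum>a\<le>k. \<Sum>j\<le>k. \<Sum>i\<le>k. h i j a)"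
    for h :: "nat \<Rightarrow> nat \<Rightarrow> nat \<Rightarrow> 'a"
  proof -
    have "(\<Sum>i\<le>k. \<Sum>j\<le>k. \<Sum>a\<le>k. h i j a) = (\<Sum>j\<le>k. \<Sum>i\<le>k. \<Sum>a\<le>k. h i j a)"
      by (rule sum.swap)
    also have "\<dots> = (\<Sum>j\<le>k. \<Sum>a\<le>k. \<Sum>i\<le>k. h i j a)"
      by (intro sum.cong refl sum.swap)
    also have "\<dots> = (\<Sum>a\<le>k. \<Sum>j\<le>k. \<Sum>i\<le>k. h i j a)"
      by (rule sum.swap)
    finally show ?thesis .
  qed
  have AB: "(\<Sum>i\<le>k. A (k - a) i * B i m) = of_bool (k - a = m)" for a
    using Suc[of "k - a"] by (simp add: ext flip: A_def B_def)
  have "(\<Sum>n\<le>k. A k n * B n (Suc m)) =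
      (\<Sum>n\<le>k. \<Sum>i\<le>n. A k (i + (n - i)) * (B i m * (r ^ (m * (n - i)) * fps_nth f (n - i))))"
    unfolding B_def qpoch_Suc fps_mult_nth sum_distrib_left fps_dilate_nth
    by (simp add: atLeast0AtMost power_mult)
  also have "\<dots> = (\<Sum>i\<le>k. \<Sum>j\<le>k. A k (i + j) * (B i m * (r ^ (m * j) * fps_nth f j)))"
    by (rule sum_triangle) (simp add: A0)
  also have "\<dots> = (\<Sum>i\<le>k. \<Sum>j\<le>k. \<Sum>a\<le>k. A a j * s ^ (j * (k - a)) * r ^ (m * j) * fps_nth f j *
      (A (k - a) i * B i m))"
    unfolding A_add by (simp add: sum_distrib_left sum_distrib_right mult_ac)
  also have "\<dots> = (\<Sum>a\<le>k. \<Sum>j\<le>k. \<Sum>i\<le>k. A a j * s ^ (j * (k - a)) * r ^ (m * j) * fps_nth f j *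
      (A (k - a) i * B i m))"
    by (rule swap3)
  also have "\<dots> = (\<Sum>a\<le>k. \<Sum>j\<le>k. A a j * s ^ (j * (k - a)) * r ^ (m * j) * fps_nth f j *
      (\<Sum>i\<le>k. A (k - a) i * B i m))"
    by (simp add: sum_distrib_left)
  also have "\<dots> = (\<Sum>a\<le>k. \<Sum>j\<le>k. A a j * s ^ (j * (k - a)) * r ^ (m * j) * fps_nth f j *
      of_bool (k - a = m))"
    by (simp only: AB)
  also have "\<dots> = (\<Sum>a\<le>k. of_bool (k - a = m) * (\<Sum>j\<le>a. fps_nth f j * A a j))"
  proof (intro sum.cong refl)
    fix a assume a: "a \<in> {..k}"
    show "(\<Sum>j\<le>k. A a j * s ^ (j * (k - a)) * r ^ (m * j) * fps_nth f j * of_bool (k - a = m)) =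
        of_bool (k - a = m) * (\<Sum>j\<le>a. fps_nth f j * A a j)"
    proof (cases "k - a = m")
      case True
      \<comment> \<open>Dilating z^m by s^j costs s^(jm), and the last factor f(r^m z) brings
        r^(mj). These cancel, and what remains is the defining equation \<open>fg\<close> shifted by
        z^m.\<close>
      have "s ^ (j * m) * r ^ (m * j) = 1" for j
        using rs by (simp add: mult.commute flip: power_mult_distrib)
      then have "A a j * s ^ (j * m) * r ^ (m * j) * c = A a j * c" for j c
        by (simp add: mult.assoc[of "A a j"])
      then show ?thesis using a by (simp add: True ext mult.commute)
    qed simp
  qed
  also have "\<dots> = (\<Sum>a\<le>k. of_bool (k - a = m) * of_bool (a = 1))"
    using fg by (simp add: A_def)
  also have "\<dots> = of_bool (k = Suc m)"
  proof (cases "k \<ge> 1")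
    case True
    have "(\<Sum>a\<le>k. of_bool (k - a = m) * of_bool (a = 1)) =
        (\<Sum>a\<in>{1}. of_bool (k - a = m) * (of_bool (a = 1) :: 'a))"
      using True by (intro sum.mono_neutral_right) auto
    then show ?thesis using True by auto
  qed auto
  finally show ?case by (simp add: A_def B_def)
qed

lemma q_prod_eq_qpoch: "q_prod r g n = qpoch g (1 / r) n"
  unfolding q_prod_def qpoch_def
  by (intro prod.cong refl fps_ext) (simp add: fps_compose_linear power_divide)

lemma q_lagrange_inverse_sum:
  assumes "q_lagrange_inverse r f g" "fps_nth f 0 = 0"
  shows "(\<Sum>n\<le>k. fps_nth f n * fps_nth (qpoch g (1 / r) n) k) = of_bool (k = 1)"
proof -
  have g0: "fps_nth g 0 = 0"
    and s: "(\<lambda>n. fps_const (fps_nth f (Suc n)) * q_prod r g (Suc n)) sums fps_X"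
    using assms(1) unfolding q_lagrange_inverse_def q_prod_def by auto
  have "(\<Sum>n<k. fps_nth f (Suc n) * fps_nth (q_prod r g (Suc n)) k) = fps_nth fps_X k"
    using s by (subst (asm) fps_sums_iff) (auto simp: q_prod_nth_less[OF g0])
  then show ?thesis using assms(2)
    by (simp add: q_prod_eq_qpoch sum.atMost_shift[of _ k] fps_X_def of_bool_def)
qed

text \<open>The claim is that the sum of g_m f(z) f(rz) ... f(r^(m-1) z) equals z; dividing by z and
  using f = z F turns it into the system of \<open>qcoef\<close>. In matrix form it says B g = e_1,
  whereas \<open>qpoch_inverse\<close> supplies A B = I, and g is the column A e_1.\<close>

lemma t_seq_eq_qcoef:
  assumes r: "r \<noteq> 0" and F: "fps_nth F 0 = 1"
    and g: "q_lagrange_inverse r (fps_X * F) (g r)"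
  shows "t_seq g n r = qcoef F r n"
  unfolding t_seq_def
proof (rule qcoef_unique[OF F])
  fix n
  define f where "f = fps_X * F"
  define A where "A k n = fps_nth (qpoch (g r) (1 / r) n) k" for k n
  define B where "B n m = fps_nth (qpoch f r m) n" for n m
  have g0: "fps_nth (g r) 0 = 0" using g by (simp add: q_lagrange_inverse_def)
  have f0: "fps_nth f 0 = 0" by (simp add: f_def)
  have AB: "(\<Sum>n\<le>k. A k n * B n m) = of_bool (k = m)" for k m
    unfolding A_def B_def
    by (rule qpoch_inverse[OF _ f0 g0 q_lagrange_inverse_sum[OF _ f0]])
      (use r g in \<open>simp_all add: f_def\<close>)
  have B0: "B n m = 0" if "n < m" for n m
    using qpoch_nth_less[OF f0 that] by (simp add: B_def)
  have Ann: "A k k \<noteq> 0" for k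
  proof
    assume "A k k = 0"
    then have "(\<Sum>n\<le>k. A k n * B n k) = 0"
      by (intro sum.neutral) (metis B0 atMost_iff mult_eq_0_iff order_le_less)
    then show False using AB[of k k] by simp
  qed
  \<comment> \<open>This is B g. From A B = I follows A c = g = A e_1, and c = e_1 results by
    forward substitution, as A is lower triangular with nonzero diagonal.\<close>
  define c where "c k = (\<Sum>n\<le>k. B k n * fps_nth (g r) n)" for k
  have c_sum: "(\<Sum>n\<le>k. A k n * c n) = fps_nth (g r) k" for k
  proof -
    have "(\<Sum>n\<le>k. A k n * c n) = (\<Sum>n\<le>k. A k n * (\<Sum>m\<le>k. B n m * fps_nth (g r) m))"
      unfolding c_def
      by (intro sum.cong refl arg_cong2[where f = "(*)"] sum.mono_neutral_left) (auto simp: B0)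
    also have "\<dots> = (\<Sum>m\<le>k. (\<Sum>n\<le>k. A k n * B n m) * fps_nth (g r) m)"
      unfolding sum_distrib_left sum_distrib_right by (subst sum.swap) (simp add: mult.assoc)
    also have "\<dots> = fps_nth (g r) k"
      unfolding AB by (simp add: of_bool_def if_distrib[of "\<lambda>x. x * _"] cong: if_cong)
    finally show ?thesis .
  qed
  have c_eq: "c k = of_bool (k = 1)" for k
  proof (induction k rule: less_induct)
    case (less k)
    have A1: "A k 1 = fps_nth (g r) k" by (simp add: A_def qpoch_def)
    have "(\<Sum>n<k. A k n * c n) + A k k * c k = fps_nth (g r) k"
      using c_sum[of k] by (simp add: lessThan_Suc_atMost[symmetric])
    moreover have "(\<Sum>n<k. A k n * c n) = (\<Sum>n<k. A k n * of_bool (n = 1))"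
      using less by simp
    moreover have "(\<Sum>n<k. A k n * of_bool (n = 1)) = of_bool (1 < k) * A k 1"
      by (cases "1 < k") (simp_all add: of_bool_def if_distrib[of "\<lambda>x. _ * x"] cong: if_cong)
    ultimately have "A k k * c k = A k k * of_bool (k = 1)"
      using A1 g0 by (cases k rule: linorder_cases[of 1]) auto
    then show ?case using Ann[of k] by simp
  qed
  have "(\<Sum>k\<le>n. r ^ (Suc k choose 2) * fps_nth (g r) (Suc k) * fps_nth (qpoch F r (Suc k)) (n - k)) =
      (\<Sum>k\<le>n. B (Suc n) (Suc k) * fps_nth (g r) (Suc k))"
  proof (intro sum.cong refl)
    fix k assume "k \<in> {..n}"
    then have "B (Suc n) (Suc k) = r ^ (Suc k choose 2) * fps_nth (qpoch F r (Suc k)) (n - k)"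
      unfolding B_def f_def qpoch_fps_X_mult mult.assoc
      by (simp add: fps_X_power_mult_nth del: power_Suc)
    then show "r ^ (Suc k choose 2) * fps_nth (g r) (Suc k) * fps_nth (qpoch F r (Suc k)) (n - k) =
        B (Suc n) (Suc k) * fps_nth (g r) (Suc k)" by simp
  qed
  also have "\<dots> = c (Suc n)"
    unfolding c_def by (subst sum.atMost_Suc_shift) (simp add: g0)
  finally show "(\<Sum>k\<le>n. r ^ (Suc k choose 2) * fps_nth (g r) (Suc k) *
      fps_nth (qpoch F r (Suc k)) (n - k)) = of_bool (n = 0)"
    by (simp add: c_eq)
qed

subsection \<open>The infinite products\<close>

lemma eval_fps_dilate: "eval_fps (fps_dilate q W) x = eval_fps W (q * x)"
  by (simp add: eval_fps_def power_mult_distrib mult_ac)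

text \<open>Multiplied by W(q), the partial products telescope to W(q^(n+1)), which tends to W(0) =
  1 by continuity.\<close>

lemma prodinf_eval_fps_fixed:
  fixes F W :: "real fps"
  assumes q: "0 < q" "q < 1" and W0: "fps_nth W 0 = 1" and FW: "F * W = fps_dilate q W"
    and rF: "fps_conv_radius F \<ge> 1" and rW: "fps_conv_radius W \<ge> 1"
  shows "(\<Prod>j. eval_fps F (q ^ Suc j)) = 1 / eval_fps W q"
proof -
  have lt: "ereal (norm (q ^ Suc k)) < fps_conv_radius G"
    if "fps_conv_radius G \<ge> 1" for G :: "real fps" and k
  proof -
    have "norm (q ^ Suc k) < 1" using q by (simp add: power_Suc_less_one del: power_Suc)
    then have "ereal (norm (q ^ Suc k)) < 1" by (metis ereal_less(3))
    then show ?thesis using that by (rule less_le_trans)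
  qed
  have step: "eval_fps F (q ^ Suc k) * eval_fps W (q ^ Suc k) = eval_fps W (q ^ Suc (Suc k))" for k
    using eval_fps_mult[OF lt[OF rF, of k] lt[OF rW, of k]] by (simp add: FW eval_fps_dilate)
  have prod: "(\<Prod>k<n. eval_fps F (q ^ Suc k)) * eval_fps W q = eval_fps W (q ^ Suc n)" for n
  proof (induction n)
    case (Suc n)
    have "(\<Prod>k<Suc n. eval_fps F (q ^ Suc k)) * eval_fps W q =
        eval_fps F (q ^ Suc n) * ((\<Prod>k<n. eval_fps F (q ^ Suc k)) * eval_fps W q)"
      by (simp add: mult_ac)
    then show ?case unfolding Suc step .
  qed simp
  have "isCont (eval_fps W) 0"
    by (rule continuous_eval_fps) (use less_le_trans[of "0::ereal", OF _ rW] in \<open>simp flip: zero_ereal_def\<close>)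
  moreover have "(\<lambda>n. q ^ Suc n) \<longlonglongrightarrow> 0"
    using q by (intro LIMSEQ_Suc LIMSEQ_realpow_zero) auto
  ultimately have "(\<lambda>n. eval_fps W (q ^ Suc n)) \<longlonglongrightarrow> 1"
    using isCont_tendsto_compose[of 0 "eval_fps W"] W0 by (metis eval_fps_at_0)
  then have lim: "(\<lambda>n. (\<Prod>k<n. eval_fps F (q ^ Suc k)) * eval_fps W q) \<longlonglongrightarrow> 1"
    by (simp only: prod)
  \<comment> \<open>If W(q) were 0, all the telescoped products would be 0 and could not tend to
    1.\<close>
  have nz: "eval_fps W q \<noteq> 0"
  proof
    assume "eval_fps W q = 0"
    with lim show False using LIMSEQ_unique[of "\<lambda>_. 0 :: real" 0 1] by simp
  qed
  have "(\<lambda>n. (\<Prod>k<n. eval_fps F (q ^ Suc k)) * eval_fps W q / eval_fps W q) \<longlonglongrightarrow> 1 / eval_fps W q"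
    by (intro tendsto_intros lim nz)
  then have "(\<lambda>n. \<Prod>k<n. eval_fps F (q ^ Suc k)) \<longlonglongrightarrow> 1 / eval_fps W q"
    using nz by simp
  then show ?thesis by (rule prodinf_eq_prod_lim') (use nz in simp)
qed

text \<open>The substitution z = q^s in a series in z whose coefficients are series in q, where
  \<open>fps_X\<close> plays q. For s \<ge> 1 the terms with m > j do not reach q^j, so the cut-off
  at m = j loses nothing.\<close>

definition fps_subst_X_power :: "nat \<Rightarrow> 'a::comm_ring_1 fps fps \<Rightarrow> 'a fps" where
  "fps_subst_X_power s G = Abs_fps (\<lambda>j. \<Sum>m\<le>j. fps_nth (fps_nth G m * fps_X ^ (s * m)) j)"

lemma fps_subst_X_power_nth:
  assumes "s \<ge> 1" "j \<le> N"
  shows "fps_nth (fps_subst_X_power s G) j = (\<Sum>m\<le>N. fps_nth (fps_nth G m * fps_X ^ (s * m)) j)"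
proof -
  have "fps_nth (fps_nth G m * fps_X ^ (s * m)) j = 0" if "m > j" for m
  proof -
    have "m \<le> s * m" using assms(1) by simp
    then have "j < s * m" using that by linarith
    then show ?thesis by (simp add: fps_X_power_mult_right_nth)
  qed
  then show ?thesis
    unfolding fps_subst_X_power_def using assms(2)
    by (auto intro!: sum.mono_neutral_left simp flip: not_less)
qed

text \<open>Up to q^j both factors may be replaced by the finite sums \<open>P\<close>, cut off at
  the same index j. Their product is a double sum, and regrouping it by a + b yields the Cauchy
  product.\<close>

lemma fps_subst_X_power_mult:
  assumes s: "s \<ge> 1"
  shows "fps_subst_X_power s (G * H) = fps_subst_X_power s G * fps_subst_X_power s H"
proof (rule fps_ext)
  fix j
  define P where "P G = (\<Sum>m\<le>j. fps_nth G m * fps_X ^ (s * m))" for G :: "'a fps fps"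
  have P: "fps_nth (fps_subst_X_power s G) i = fps_nth (P G) i" if "i \<le> j" for i G
    using fps_subst_X_power_nth[OF s that, of G] by (simp add: P_def fps_sum_nth)
  define h where "h a b = fps_nth (fps_nth G a * fps_nth H b * fps_X ^ (s * (a + b))) j" for a b
  have h0: "h a b = 0" if "j < a + b" for a b
  proof -
    have "a + b \<le> s * (a + b)" using s by simp
    then have "j < s * (a + b)" using that by linarith
    then show ?thesis by (simp add: h_def fps_X_power_mult_right_nth)
  qed
  have "fps_nth (fps_subst_X_power s G * fps_subst_X_power s H) j = fps_nth (P G * P H) j"
    unfolding fps_mult_nth by (intro sum.cong) (simp_all add: P)
  also have "\<dots> = (\<Sum>a\<le>j. \<Sum>b\<le>j. h a b)"
    unfolding P_def sum_product fps_sum_nth h_def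
    by (intro sum.cong refl) (simp add: distrib_left power_add mult_ac)
  also have "\<dots> = (\<Sum>m\<le>j. \<Sum>a\<le>m. h a (m - a))"
    by (rule sum_triangle[symmetric]) (rule h0)
  also have "\<dots> = fps_nth (P (G * H)) j"
    unfolding P_def fps_sum_nth
  proof (intro sum.cong refl)
    fix m
    have "(\<Sum>a\<le>m. h a (m - a)) =
        fps_nth (\<Sum>a\<le>m. fps_nth G a * fps_nth H (m - a) * fps_X ^ (s * m)) j"
      unfolding fps_sum_nth h_def by (intro sum.cong) simp_all
    also have "(\<Sum>a\<le>m. fps_nth G a * fps_nth H (m - a) * fps_X ^ (s * m)) =
        fps_nth (G * H) m * fps_X ^ (s * m)"
      by (simp add: fps_mult_nth sum_distrib_right atLeast0AtMost)
    finally show "(\<Sum>a\<le>m. h a (m - a)) = fps_nth (fps_nth (G * H) m * fps_X ^ (s * m)) j" .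
  qed
  finally show "fps_nth (fps_subst_X_power s (G * H)) j =
      fps_nth (fps_subst_X_power s G * fps_subst_X_power s H) j"
    by (simp add: P)
qed

lemma fps_subst_X_power_dilate:
  "fps_subst_X_power s (fps_dilate fps_X G) = fps_subst_X_power (Suc s) G"
  by (simp add: fps_subst_X_power_def power_add mult_ac)

lemma fps_subst_X_power_const:
  "fps_subst_X_power s (Abs_fps (\<lambda>m. fps_const (fps_nth F m))) = fps_compose F (fps_X ^ s)"
  by (rule fps_ext)
    (simp add: fps_subst_X_power_def fps_compose_nth atLeast0AtMost power_mult)

lemma fps_subst_X_power_nth_less:
  assumes "j < s" "fps_nth G 0 = 1"
  shows "fps_nth (fps_subst_X_power s G) j = of_bool (j = 0)"
proof -
  have "fps_nth (fps_nth G m * fps_X ^ (s * m)) j = of_bool (m = 0) * of_bool (j = 0)" for m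
  proof (cases m)
    case (Suc k)
    have "j < s * m" using assms(1) by (simp add: Suc trans_less_add1)
    then show ?thesis by (simp add: fps_X_power_mult_right_nth Suc)
  qed (use assms(2) in simp)
  then show ?thesis
    unfolding fps_subst_X_power_def fps_nth_Abs_fps by (simp add: sum.atMost_shift)
qed

text \<open>Formal counterpart of \<open>prodinf_eval_fps_fixed\<close>: with \<open>E s\<close> for
  W(q^s), the partial products times \<open>E 1\<close> telescope to \<open>E (Suc n)\<close>, which
  agrees with 1 up to q^n.\<close>

lemma L_fps_eq:
  assumes W0: "fps_nth W 0 = 1"
    and W: "Abs_fps (\<lambda>m. fps_const (fps_nth (1 - \<phi>) m)) * W = fps_dilate fps_X W"
    and phi0: "fps_nth \<phi> 0 = 0"
  shows "L_fps \<phi> = fps_subst_X_power 1 W"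
proof -
  define E where "E s = fps_subst_X_power s W" for s
  define F where "F j = 1 - fps_compose \<phi> (fps_X ^ Suc j)" for j
  have step: "F j * E (Suc j) = E (Suc (Suc j))" for j
  proof -
    have "F j = fps_subst_X_power (Suc j) (Abs_fps (\<lambda>m. fps_const (fps_nth (1 - \<phi>) m)))"
      unfolding fps_subst_X_power_const F_def by (simp add: fps_compose_sub_distrib)
    then have "F j * E (Suc j) = fps_subst_X_power (Suc j) (fps_dilate fps_X W)"
      unfolding E_def W[symmetric] by (simp only: fps_subst_X_power_mult)
    then show ?thesis by (simp only: E_def fps_subst_X_power_dilate)
  qed
  have prod: "(\<Prod>j<n. F j) * E 1 = E (Suc n)" for n
  proof (induction n)
    case (Suc n)
    then show ?case using step[of n] by (simp add: mult_ac)
  qed simp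
  have E_nth: "fps_nth (E (Suc n)) j = of_bool (j = 0)" if "j \<le> n" for n j
    unfolding E_def by (rule fps_subst_X_power_nth_less) (use that W0 in auto)
  have E1: "fps_nth (E 1) 0 = 1" using E_nth[of 0 0] by simp
  have inv: "E 1 * inverse (E 1) = 1"
    using E1 by (simp add: inverse_mult_eq_1')
  have "(\<lambda>n. \<Prod>j<n. F j) \<longlonglongrightarrow> inverse (E 1)"
    unfolding tendsto_fps_iff
  proof (intro allI)
    fix k
    have "fps_nth (\<Prod>j<n. F j) k = fps_nth (inverse (E 1)) k" if "n \<ge> k" for n
    proof -
      have "(\<Prod>j<n. F j) = inverse (E 1) * E (Suc n)"
        unfolding prod[symmetric] by (metis inv mult.commute mult.left_commute mult_1)
      then have "fps_nth (\<Prod>j<n. F j) k = fps_nth (inverse (E 1) * E (Suc n)) k"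
        by (simp only:)
      also have "\<dots> = (\<Sum>i=0..k. fps_nth (inverse (E 1)) i * of_bool (k - i = 0))"
        unfolding fps_mult_nth by (intro sum.cong refl) (use that in \<open>simp add: E_nth\<close>)
      also have "\<dots> = (\<Sum>i\<in>{k}. fps_nth (inverse (E 1)) i * of_bool (k - i = 0))"
        by (intro sum.mono_neutral_right) auto
      finally show ?thesis by simp
    qed
    then show "\<forall>\<^sub>F n in sequentially. fps_nth (\<Prod>j<n. F j) k = fps_nth (inverse (E 1)) k"
      by (rule eventually_sequentiallyI)
  qed
  then have lim: "(\<lambda>n. \<Prod>j\<le>n. F j) \<longlonglongrightarrow> inverse (E 1)"
    by (simp only: LIMSEQ_lessThan_iff_atMost)
  \<comment> \<open>The notion of a convergent product demands a nonzero limit; here the limit is a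
    unit.\<close>
  have "inverse (E 1) \<noteq> 0" using inv by (metis mult_zero_right zero_neq_one)
  with lim have "raw_has_prod F 0 (inverse (E 1))"
    by (simp add: raw_has_prod_def)
  then have "F has_prod inverse (E 1)" by (simp add: has_prod_def)
  then have "prodinf F = inverse (E 1)" by (metis has_prod_unique)
  then have "L_fps \<phi> = inverse (inverse (E 1))" by (simp add: L_fps_def F_def[abs_def])
  then show ?thesis using E1 by (simp add: E_def fps_inverse_idempotent)
qed

subsection \<open>Regularly varying sequences\<close>

lemma nat_floor_eq: "real m \<le> x \<Longrightarrow> x < real m + 1 \<Longrightarrow> nat \<lfloor>x\<rfloor> = m"
  by linarith

lemma nat_floor_bounds: "0 \<le> x \<Longrightarrow> real (nat \<lfloor>x\<rfloor>) \<le> x \<and> x < real (nat \<lfloor>x\<rfloor>) + 1"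
  by linarith

text \<open>Rescaling k = n x turns a series into an integral over x. Pointwise limits in lambda =
  x, which are all that regular variation offers, can then be integrated by dominated
  convergence.\<close>

lemma has_bochner_integral_floor:
  fixes c :: "nat \<Rightarrow> real"
  assumes n: "n > 0" and c: "\<And>k. c k \<ge> 0" "summable c"
  shows "has_bochner_integral lborel (\<lambda>x. indicator {0..} x * c (nat \<lfloor>real n * x\<rfloor>)) (suminf c / real n)"
proof -
  define I where "I k = {real k / real n ..< (real k + 1) / real n}" for k :: nat
  define h where "h k x = indicator (I k) x * c k" for k x
  have h_int: "has_bochner_integral lborel (h k) (c k / real n)" for k
  proof -
    have "emeasure lborel (I k) = ennreal ((real k + 1) / real n - real k / real n)"
      unfolding I_def by (intro emeasure_lborel_Ico divide_right_mono) auto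
    then have "has_bochner_integral lborel (indicator (I k)) (measure lborel (I k))"
      by (intro has_bochner_integral_real_indicator) (auto simp: I_def)
    then have "has_bochner_integral lborel (h k) (measure lborel (I k) * c k)"
      unfolding h_def by (intro has_bochner_integral_mult_left)
    moreover have "measure lborel (I k) = 1 / real n"
      using n by (simp add: I_def field_simps)
    ultimately show ?thesis by simp
  qed
  have h_sum: "(\<lambda>k. h k x) sums (indicator {0..} x * c (nat \<lfloor>real n * x\<rfloor>))" for x
  proof (cases "x \<ge> 0")
    case True
    define m where "m = nat \<lfloor>real n * x\<rfloor>"
    have I_iff: "x \<in> I k \<longleftrightarrow> k = m" for k
    proof -
      have "x \<in> I k \<longleftrightarrow> real k \<le> real n * x \<and> real n * x < real k + 1"
        using n by (simp add: I_def field_simps)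
      also have "\<dots> \<longleftrightarrow> k = m"
        using nat_floor_eq[of k "real n * x"] nat_floor_bounds[of "real n * x"] True
        by (auto simp: m_def)
      finally show ?thesis .
    qed
    have "(\<lambda>k. h k x) = (\<lambda>k. if k = m then h k x else 0)"
      by (auto simp: h_def I_iff indicator_def)
    then have "(\<lambda>k. h k x) sums h m x"
      using sums_single[of m "\<lambda>k. h k x"] by simp
    then show ?thesis using True by (simp add: h_def I_iff m_def indicator_def)
  next
    case False
    have "x \<notin> I k" for k
    proof
      assume "x \<in> I k"
      then have "real k / real n \<le> x" by (simp add: I_def)
      moreover have "0 \<le> real k / real n" by simp
      ultimately show False using False by linarith
    qed
    then have "h k x = 0" for k by (simp add: h_def)
    then show ?thesis using False by simp
  qed
  have nrm: "norm (h k x) = h k x" for k x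
    using c(1) by (simp add: h_def)
  have "(\<lambda>k. c k / real n) sums (suminf c / real n)"
    by (intro sums_divide summable_sums c)
  then have summ: "summable (\<lambda>k. \<integral>x. norm (h k x) \<partial>lborel)"
    unfolding nrm has_bochner_integral_integral_eq[OF h_int] by (rule sums_summable)
  have *: "integrable lborel (h k)" for k using h_int by (rule integrable.intros)
  have AE: "AE x in lborel. summable (\<lambda>k. norm (h k x))"
    unfolding nrm using h_sum by (auto intro: sums_summable)
  have "integrable lborel (\<lambda>x. \<Sum>k. h k x)"
    and "(\<integral>x. (\<Sum>k. h k x) \<partial>lborel) = (\<Sum>k. \<integral>x. h k x \<partial>lborel)"
    using integrable_suminf[OF * AE summ] integral_suminf[OF * AE summ] by auto
  moreover have "(\<Sum>k. \<integral>x. h k x \<partial>lborel) = suminf c / real n"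
    unfolding has_bochner_integral_integral_eq[OF h_int]
    by (rule sums_unique[symmetric]) (intro sums_divide summable_sums c)
  moreover have "(\<lambda>x. \<Sum>k. h k x) = (\<lambda>x. indicator {0..} x * c (nat \<lfloor>real n * x\<rfloor>))"
    using h_sum by (auto simp: sums_iff)
  ultimately show ?thesis by (simp add: has_bochner_integral_iff)
qed

section \<open>Shifts, bounded ratios and Potter bounds\<close>

lemma regularly_varying_seq_nat:
  assumes "regularly_varying_seq a \<alpha>" "lam > 0"
  shows "(\<lambda>n. a (nat \<lfloor>real n * lam\<rfloor>) / a n) \<longlonglongrightarrow> lam powr \<alpha>"
proof -
  have "((\<lambda>t::real. a (nat \<lfloor>lam * t\<rfloor>) / a (nat \<lfloor>t\<rfloor>)) \<longlongrightarrow> lam powr \<alpha>) at_top"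
    using assms unfolding regularly_varying_seq_def by blast
  from filterlim_compose[OF this filterlim_real_sequentially]
  show ?thesis by (simp add: mult.commute)
qed

text \<open>The case lambda = 1: as x / 0 = 0, a quotient a_n / a_n tending to 1 excludes zeros
  eventually.\<close>

lemma regularly_varying_seq_nonzero:
  assumes "regularly_varying_seq a \<alpha>"
  shows "\<forall>\<^sub>F n in sequentially. a n \<noteq> 0"
proof -
  have "(\<lambda>n. a (nat \<lfloor>real n * 1\<rfloor>) / a n) \<longlonglongrightarrow> 1 powr \<alpha>"
    by (rule regularly_varying_seq_nat[OF assms]) simp
  then have "\<forall>\<^sub>F n in sequentially. a (nat \<lfloor>real n * 1\<rfloor>) / a n > 0"
    by (rule order_tendstoD) simp
  then show ?thesis by eventually_elim auto
qed

text \<open>For irrational \<open>\<lambda>\<close>, the functions \<open>\<lfloor>t\<rfloor>\<close> and \<open>\<lfloor>\<lambda>t\<rfloor>\<close> never jump at the same \<open>t > 0\<close>, so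
  both \<open>m\<close> and \<open>m + 1\<close> are compared with the same term \<open>a\<^bsub>\<lfloor>t\<rfloor>\<^esub>\<close>.\<close>

lemma regularly_varying_seq_Suc:
  assumes rv: "regularly_varying_seq a \<alpha>"
  shows "(\<lambda>n. a (Suc n) / a n) \<longlonglongrightarrow> 1"
proof -
  have "\<not> {1 <..< 2 :: real} \<subseteq> \<rat>"
    using countable_rat countable_subset uncountable_open_interval[of 1 "2 :: real"] by auto
  then obtain s :: real where "s \<in> {1 <..< 2}" and s_irrat: "s \<notin> \<rat>" by blast
  then have s: "s > 1" by simp
  \<comment> \<open>The point where floor(s t) jumps to m + 1. It is not an integer because s is
    irrational, so floor(t) is constant around it.\<close>
  define t where "t m = (real m + 1) / s" for m :: nat
  \<comment> \<open>A point just before the jump: being at least floor(t m) it keeps the floor of t,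
    and being at least m / s it gives floor(s t) = m.\<close>
  define t' where "t' m = max (real (nat \<lfloor>t m\<rfloor>)) (real m / s)" for m
  define N where "N m = nat \<lfloor>t m\<rfloor>" for m
  have t_pos: "t m > 0" for m using s by (simp add: t_def)
  have not_int: "t m \<noteq> real k" for m k
  proof
    assume eq: "t m = real k"
    then have "k \<noteq> 0" using t_pos[of m] by auto
    then have "s = (real m + 1) / real k" using eq s by (simp add: t_def field_simps)
    then have "s \<in> \<rat>" by simp
    then show False using s_irrat by simp
  qed
  have N_less: "real (N m) < t m" "t m < real (N m) + 1" for m
    using nat_floor_bounds[of "t m", folded N_def] t_pos[of m] not_int[of m "N m"] by linarith+
  have t'_less: "t' m < t m" for m
  proof -
    have "real m / s < t m" using s by (simp add: t_def divide_strict_right_mono)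
    then show ?thesis using N_less[of m] by (simp add: t'_def N_def)
  qed
  have f1: "nat \<lfloor>s * t m\<rfloor> = Suc m" for m
    using s by (intro nat_floor_eq) (simp_all add: t_def)
  have f2: "nat \<lfloor>t' m\<rfloor> = N m" for m
  proof (rule nat_floor_eq)
    show "real (N m) \<le> t' m" by (simp add: t'_def N_def)
    show "t' m < real (N m) + 1" using t'_less[of m] N_less(2)[of m] by linarith
  qed
  have f3: "nat \<lfloor>s * t' m\<rfloor> = m" for m
  proof (rule nat_floor_eq)
    have "s * (real m / s) \<le> s * t' m"
      using s by (intro mult_left_mono) (auto simp: t'_def)
    then show "real m \<le> s * t' m" using s by simp
    have "s * t' m < s * t m" using s t'_less by (intro mult_strict_left_mono) auto
    then show "s * t' m < real m + 1" using s by (simp add: t_def)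
  qed
  have lim_s: "((\<lambda>t::real. a (nat \<lfloor>s * t\<rfloor>) / a (nat \<lfloor>t\<rfloor>)) \<longlongrightarrow> s powr \<alpha>) at_top"
    using rv s unfolding regularly_varying_seq_def by auto
  have t'_top: "filterlim t' at_top sequentially"
  proof (rule filterlim_at_top_mono)
    show "filterlim (\<lambda>m. real m / s) at_top sequentially"
      using s by real_asymp
  qed (auto simp: t'_def)
  have t_top: "filterlim t at_top sequentially"
    unfolding t_def using s by real_asymp
  have l1: "(\<lambda>m. a (Suc m) / a (N m)) \<longlonglongrightarrow> s powr \<alpha>"
    using filterlim_compose[OF lim_s t_top] by (simp add: f1 N_def)
  have l2: "(\<lambda>m. a m / a (N m)) \<longlonglongrightarrow> s powr \<alpha>"
    using filterlim_compose[OF lim_s t'_top] by (simp add: f2 f3)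
  have lim: "(\<lambda>m. (a (Suc m) / a (N m)) / (a m / a (N m))) \<longlonglongrightarrow> s powr \<alpha> / s powr \<alpha>"
    using s by (intro tendsto_divide l1 l2) auto
  have "\<forall>\<^sub>F m in sequentially. a m / a (N m) > 0"
    using l2 by (rule order_tendstoD) (use s in auto)
  then have "\<forall>\<^sub>F m in sequentially. (a (Suc m) / a (N m)) / (a m / a (N m)) = a (Suc m) / a m"
    by eventually_elim auto
  from Lim_transform_eventually[OF lim this] show ?thesis using s by simp
qed

lemma regularly_varying_seq_shift:
  assumes rv: "regularly_varying_seq a \<alpha>"
  shows "(\<lambda>n. a (n - m) / a n) \<longlonglongrightarrow> 1"
proof -
  have "(\<lambda>n. a n / a (n + m)) \<longlonglongrightarrow> 1"
  proof (induction m)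
    case 0
    have "\<forall>\<^sub>F n in sequentially. a n / a n = 1"
      using regularly_varying_seq_nonzero[OF rv] by eventually_elim simp
    then show ?case by (simp add: tendsto_eventually)
  next
    case (Suc m)
    have "(\<lambda>n. a (Suc (n + m)) / a (n + m)) \<longlonglongrightarrow> 1"
      using LIMSEQ_ignore_initial_segment[OF regularly_varying_seq_Suc[OF rv], of m] by simp
    then have lim: "(\<lambda>n. a n / a (n + m) / (a (Suc (n + m)) / a (n + m))) \<longlonglongrightarrow> 1 / 1"
      by (intro tendsto_divide Suc) auto
    have "\<forall>\<^sub>F n in sequentially. a (n + m) \<noteq> 0"
      using regularly_varying_seq_nonzero[OF rv]
      by (subst eventually_sequentially_seg[of "\<lambda>n. a n \<noteq> 0"])
    then have "\<forall>\<^sub>F n in sequentially.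
        a n / a (n + m) / (a (Suc (n + m)) / a (n + m)) = a n / a (n + Suc m)"
      by eventually_elim simp
    from Lim_transform_eventually[OF lim this] show ?case by simp
  qed
  then have "(\<lambda>n. a (n + m - m) / a (n + m)) \<longlonglongrightarrow> 1" by simp
  then show ?thesis by (rule LIMSEQ_offset)
qed

text \<open>By dominated convergence, the set of \<open>\<lambda> \<in> [1, 4]\<close> for which \<open>a\<^bsub>\<lfloor>\<lambda>n\<rfloor>\<^esub>/a\<^sub>n\<close> is not of
  constant order has measure tending to \<open>0\<close>. Hence for \<open>n \<le> m \<le> 2n\<close> some \<open>k\<close> between \<open>m\<close> and \<open>4n\<close> is
  comparable with both \<open>n\<close> and \<open>m\<close>. This replaces the uniform convergence theorem.\<close>

lemma regularly_varying_seq_bounded_ratio: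
  assumes rv: "regularly_varying_seq a \<alpha>" and nonneg: "\<And>n. a n \<ge> 0"
  obtains C N where "C > 0"
    "\<And>m n. N \<le> n \<Longrightarrow> n \<le> m \<Longrightarrow> m \<le> 2 * n \<Longrightarrow> a m \<le> C * a n"
proof -
  \<comment> \<open>For 1 \<le> x < 4 the limit x^\<alpha> lies between 4^(-|\<alpha>|) and
    4^|\<alpha>|; the factor 2 makes both inequalities strict.\<close>
  define K :: real where "K = 2 * 4 powr \<bar>\<alpha>\<bar>"
  have K: "K > 0" by (simp add: K_def)
  define bad where "bad n k \<longleftrightarrow> \<not> (a k \<le> K * a n \<and> a n \<le> K * a k)" for n k
  \<comment> \<open>\<open>card (B n) / n\<close> is the measure of the bad lambda in [1, 4), as
    lambda = x corresponds to the index floor(n x).\<close>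
  define B where "B n = {k \<in> {n..<4 * n}. bad n k}" for n
  define c :: "nat \<Rightarrow> nat \<Rightarrow> real" where "c n k = of_bool (k \<in> B n)" for n k
  define s where "s n x = indicator {0..} x * c n (nat \<lfloor>real n * x\<rfloor>)" for n x
  have finB: "finite (B n)" for n by (simp add: B_def)
  have c_sums: "c n sums real (card (B n))" for n
    using sums_finite[OF finB, of n "c n"] by (simp add: c_def)
  have s_int: "has_bochner_integral lborel (s n) (real (card (B n)) / real n)" for n
  proof (cases "n = 0")
    case True
    then have "s n = (\<lambda>_. 0)" by (simp add: s_def[abs_def] c_def B_def)
    then show ?thesis using True by (simp add: has_bochner_integral_zero)
  next
    case False
    then show ?thesis
      using has_bochner_integral_floor[of n "c n"] c_sums[of n]
      by (simp add: s_def[abs_def] c_def sums_iff)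
  qed
  have s_0: "s n x = 0" if "\<not> (1 \<le> x \<and> x < 4)" for n x
  proof -
    have "nat \<lfloor>real n * x\<rfloor> \<notin> B n" if "0 \<le> x"
    proof
      assume "nat \<lfloor>real n * x\<rfloor> \<in> B n"
      then have n: "n \<le> nat \<lfloor>real n * x\<rfloor>" "nat \<lfloor>real n * x\<rfloor> < 4 * n" by (auto simp: B_def)
      have "real n \<le> real (nat \<lfloor>real n * x\<rfloor>)" "real (Suc (nat \<lfloor>real n * x\<rfloor>)) \<le> real (4 * n)"
        using n by (simp_all only: of_nat_le_iff Suc_le_eq)
      moreover have "0 \<le> real n * x" using \<open>0 \<le> x\<close> by simp
      ultimately have "real n \<le> real n * x" "real n * x < real n * 4"
        using nat_floor_bounds[of "real n * x"] by linarith+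
      moreover have "n > 0" using n by simp
      ultimately have "1 \<le> x" "x < 4" by simp_all
      then show False using \<open>\<not> (1 \<le> x \<and> x < 4)\<close> by blast
    qed
    then show ?thesis by (simp add: s_def c_def indicator_def)
  qed
  have s_lim: "(\<lambda>n. s n x) \<longlonglongrightarrow> 0" for x
  proof (cases "1 \<le> x \<and> x < 4")
    case True
    have "x powr \<alpha> \<le> x powr \<bar>\<alpha>\<bar>" "x powr - \<bar>\<alpha>\<bar> \<le> x powr \<alpha>"
      using True by (auto intro!: powr_mono)
    moreover have "x powr \<bar>\<alpha>\<bar> \<le> 4 powr \<bar>\<alpha>\<bar>"
      using True by (intro powr_mono2) auto
    moreover have "4 powr - \<bar>\<alpha>\<bar> \<le> x powr - \<bar>\<alpha>\<bar>"
      using True by (intro powr_mono2') auto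
    moreover have "4 powr \<bar>\<alpha>\<bar> < K" "1 / K < 4 powr - \<bar>\<alpha>\<bar>"
      by (simp_all add: K_def powr_minus field_simps)
    ultimately have "x powr \<alpha> < K" "1 / K < x powr \<alpha>" by linarith+
    moreover have lim: "(\<lambda>n. a (nat \<lfloor>real n * x\<rfloor>) / a n) \<longlonglongrightarrow> x powr \<alpha>"
      using True by (intro regularly_varying_seq_nat rv) auto
    ultimately have "\<forall>\<^sub>F n in sequentially. a (nat \<lfloor>real n * x\<rfloor>) / a n < K"
      "\<forall>\<^sub>F n in sequentially. 1 / K < a (nat \<lfloor>real n * x\<rfloor>) / a n"
      using order_tendstoD by blast+
    then have "\<forall>\<^sub>F n in sequentially. s n x = 0"
      using regularly_varying_seq_nonzero[OF rv]
    proof eventually_elim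
      case (elim n)
      have "a n > 0" using nonneg[of n] elim by simp
      then have "\<not> bad n (nat \<lfloor>real n * x\<rfloor>)"
        using elim K by (simp add: bad_def field_simps)
      then show ?case by (simp add: s_def c_def B_def)
    qed
    then show ?thesis by (rule tendsto_eventually)
  qed (simp add: s_0)
  have "(\<lambda>n. integral\<^sup>L lborel (s n)) \<longlonglongrightarrow> integral\<^sup>L lborel (\<lambda>x :: real. 0 :: real)"
  proof (rule integral_dominated_convergence[where w = "indicator {1..4::real}"])
    show "s n \<in> borel_measurable lborel" for n
      using s_int[of n] by (auto simp: has_bochner_integral_iff)
    show "AE x in lborel. norm (s n x) \<le> indicator {1..4} x" for n
    proof (rule AE_I2)
      fix x
      show "norm (s n x) \<le> indicator {1..4} x"
        using s_0[of x n] by (cases "1 \<le> x \<and> x < 4") (auto simp: s_def c_def)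
    qed
  qed (use s_lim in auto)
  then have "(\<lambda>n. real (card (B n)) / real n) \<longlonglongrightarrow> 0"
    by (simp add: has_bochner_integral_integral_eq[OF s_int])
  then have "\<forall>\<^sub>F n in sequentially. real (card (B n)) / real n < 1 / 2"
    by (rule order_tendstoD) simp
  then obtain N where N: "\<And>n. n \<ge> N \<Longrightarrow> real (card (B n)) / real n < 1 / 2"
    by (auto simp: eventually_sequentially)
  show ?thesis
  proof (rule that[of "K * K" "max 1 N"])
    fix m n assume mn: "max 1 N \<le> n" "n \<le> m" "m \<le> 2 * n"
    \<comment> \<open>The reach up to 4n is what makes the count work: [m, 4n) has at least 2n
      elements, while fewer than n/2 + m/2 \<le> 3n/2 indices are bad for n or for m.\<close>
    have "\<not> {m..<4 * n} \<subseteq> B n \<union> B m"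
    proof
      assume "{m..<4 * n} \<subseteq> B n \<union> B m"
      then have "card {m..<4 * n} \<le> card (B n \<union> B m)" using finB by (intro card_mono) auto
      also have "\<dots> \<le> card (B n) + card (B m)" by (rule card_Un_le)
      finally have "4 * n - m \<le> card (B n) + card (B m)" by simp
      moreover have "2 * card (B n) < n" "2 * card (B m) < m"
        using N[of n] N[of m] mn by (auto simp: field_simps)
      ultimately show False using mn by linarith
    qed
    then obtain k where "k \<in> {m..<4 * n}" "k \<notin> B n \<union> B m" by blast
    then have k: "m \<le> k" "k < 4 * n" "k \<notin> B n" "k \<notin> B m" by auto
    then have "\<not> bad n k" "\<not> bad m k" using mn by (auto simp: B_def)
    then have "a m \<le> K * a k" "a k \<le> K * a n" by (auto simp: bad_def)
    then have "a m \<le> K * (K * a n)"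
      using K by (meson mult_left_mono less_imp_le order_trans)
    then show "a m \<le> K * K * a n" by (simp add: mult_ac)
  qed (use K in auto)
qed

text \<open>Doubling n costs a factor of at most 2^\<beta> once n is large, since a_(2n)/a_n tends
  to 2^\<alpha> < 2^\<beta>. When m \<le> 2n is reached, the bounded ratio supplies the constant
  C.\<close>

lemma regularly_varying_seq_Potter:
  assumes rv: "regularly_varying_seq a \<alpha>" and nonneg: "\<And>n. a n \<ge> 0"
    and \<beta>: "\<beta> \<ge> 0" "\<alpha> < \<beta>"
  obtains C N where "C > 0"
    "\<And>m n. N \<le> n \<Longrightarrow> 0 < n \<Longrightarrow> n \<le> m \<Longrightarrow> a m \<le> C * (real m / real n) powr \<beta> * a n"
proof -
  obtain C N1 where C: "C > 0"
    and N1: "\<And>m n. N1 \<le> n \<Longrightarrow> n \<le> m \<Longrightarrow> m \<le> 2 * n \<Longrightarrow> a m \<le> C * a n"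
    using regularly_varying_seq_bounded_ratio[OF rv nonneg] by metis
  have "(\<lambda>n. a (nat \<lfloor>real n * 2\<rfloor>) / a n) \<longlonglongrightarrow> 2 powr \<alpha>"
    by (intro regularly_varying_seq_nat rv) auto
  moreover have "nat \<lfloor>real n * 2\<rfloor> = 2 * n" for n
    by (rule nat_floor_eq) simp_all
  ultimately have "(\<lambda>n. a (2 * n) / a n) \<longlonglongrightarrow> 2 powr \<alpha>" by simp
  then have "\<forall>\<^sub>F n in sequentially. a (2 * n) / a n < 2 powr \<beta>"
    by (rule order_tendstoD) (use \<beta> in simp)
  then have "\<forall>\<^sub>F n in sequentially. a (2 * n) \<le> 2 powr \<beta> * a n"
    using regularly_varying_seq_nonzero[OF rv]
  proof eventually_elim
    case (elim n)
    have "a n > 0" using nonneg[of n] elim by simp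
    then show ?case using elim by (simp add: field_simps)
  qed
  then obtain N2 where N2: "\<And>n. n \<ge> N2 \<Longrightarrow> a (2 * n) \<le> 2 powr \<beta> * a n"
    by (auto simp: eventually_sequentially)
  have "a m \<le> C * (real m / real n) powr \<beta> * a n"
    if "max N1 N2 \<le> n" "0 < n" "n \<le> m" for m n
    using that
  proof (induction "m - n" arbitrary: n rule: less_induct)
    case less
    show ?case
    proof (cases "m \<le> 2 * n")
      case True
      have "a m \<le> C * 1 * a n" using N1[of n m] less True by simp
      also have "\<dots> \<le> C * (real m / real n) powr \<beta> * a n"
        using less C nonneg \<beta> by (intro mult_right_mono mult_left_mono ge_one_powr_ge_zero) auto
      finally show ?thesis .
    next
      case False
      have "a m \<le> C * (real m / real (2 * n)) powr \<beta> * a (2 * n)"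
        using less False by (intro less.hyps) auto
      also have "\<dots> \<le> C * (real m / real (2 * n)) powr \<beta> * (2 powr \<beta> * a n)"
        using less.prems C by (intro mult_left_mono N2) auto
      also have "\<dots> = C * ((real m / real (2 * n)) powr \<beta> * 2 powr \<beta>) * a n"
        by (simp only: mult_ac)
      also have "(real m / real (2 * n)) powr \<beta> * 2 powr \<beta> = (real m / real n) powr \<beta>"
        by (subst powr_mult[symmetric]) auto
      finally show ?thesis .
    qed
  qed
  with C show ?thesis by (intro that[of C "max N1 N2"]) auto
qed

lemma regularly_varying_seq_inverse:
  assumes "regularly_varying_seq a \<alpha>"
  shows "regularly_varying_seq (\<lambda>n. inverse (a n)) (- \<alpha>)"
  unfolding regularly_varying_seq_def
proof (intro allI impI)
  fix lam :: real assume lam: "lam > 0"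
  have "((\<lambda>t::real. inverse (a (nat \<lfloor>lam * t\<rfloor>) / a (nat \<lfloor>t\<rfloor>))) \<longlongrightarrow> inverse (lam powr \<alpha>)) at_top"
    using assms lam unfolding regularly_varying_seq_def by (intro tendsto_inverse) auto
  then show "((\<lambda>t::real. inverse (a (nat \<lfloor>lam * t\<rfloor>)) / inverse (a (nat \<lfloor>t\<rfloor>))) \<longlongrightarrow> lam powr - \<alpha>) at_top"
    by (simp add: powr_minus field_simps)
qed

text \<open>A bound for a_k/a_n over all k at once: Potter for a with exponent 1 if k \<ge> n,
  Potter for 1/a with exponent \<beta> if N \<le> k \<le> n, and the bound A for the finitely many k
  < N. The shifts by 1 keep the fraction meaningful at k = 0.\<close>

lemma regularly_varying_seq_dominated:
  assumes rv: "regularly_varying_seq a \<alpha>" and nonneg: "\<And>n. a n \<ge> 0" and le: "\<And>n. a n \<le> A"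
    and \<alpha>: "\<alpha> \<le> 0" and \<beta>: "- \<alpha> < \<beta>" "\<beta> < 1"
  obtains C N where "C > 0" "N > 0" "\<And>n. n \<ge> N \<Longrightarrow> a n > 0"
    "\<And>n k. n \<ge> N \<Longrightarrow> a k \<le> C * (((real n + 1) / (real k + 1)) powr \<beta> + real k / real n) * a n"
proof -
  have \<beta>0: "\<beta> > 0" using \<alpha> \<beta> by linarith
  have \<beta>2: "2 powr \<beta> \<le> 2 powr 1" using \<beta> by (intro powr_mono) auto
  obtain C1 N1 where C1: "C1 > 0"
    and N1: "\<And>m n. N1 \<le> n \<Longrightarrow> 0 < n \<Longrightarrow> n \<le> m \<Longrightarrow> a m \<le> C1 * (real m / real n) powr 1 * a n"
    using regularly_varying_seq_Potter[OF rv nonneg, of 1] \<alpha> by (smt (verit))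
  obtain C2 N2 where C2: "C2 > 0"
    and N2: "\<And>m n. N2 \<le> n \<Longrightarrow> 0 < n \<Longrightarrow> n \<le> m \<Longrightarrow>
      inverse (a m) \<le> C2 * (real m / real n) powr \<beta> * inverse (a n)"
    using regularly_varying_seq_Potter[OF regularly_varying_seq_inverse[OF rv], of \<beta>] nonneg \<beta>0 \<beta>(1)
    by (metis inverse_nonnegative_iff_nonnegative less_imp_le)
  obtain N3 where N3: "\<And>n. n \<ge> N3 \<Longrightarrow> a n \<noteq> 0"
    using regularly_varying_seq_nonzero[OF rv] by (auto simp: eventually_sequentially)
  define N where "N = Max {1, N1, N2, N3}"
  have N: "N \<ge> 1" "N \<ge> N1" "N \<ge> N2" "N \<ge> N3" by (auto simp: N_def)
  have pos: "a n > 0" if "n \<ge> N" for n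
    using nonneg[of n] N3[of n] N that by (simp add: less_le)
  have lower: "a n \<le> C2 * (real m / real n) powr \<beta> * a m" if "N \<le> n" "n \<le> m" for n m
    using N2[of n m] pos[of n] pos[of m] N that by (simp add: field_simps)
  have A: "A > 0" using pos[of N] le[of N] by linarith
  define D where "D = A / a N"
  have D: "D > 0" using A pos by (simp add: D_def)
  \<comment> \<open>One summand for each range of k. The 2 pays for replacing n/k by (n+1)/(k+1),
    and D for replacing \<open>a k\<close> with k < N by \<open>a N\<close>.\<close>
  define C where "C = C1 + 2 * C2 + D * C2"
  have DC: "D * C2 > 0" using D C2 by simp
  have C: "C > 0" "C1 \<le> C" "2 * C2 \<le> C" "D * C2 \<le> C" using C1 C2 DC by (auto simp: C_def)
  show ?thesis
  proof (rule that[of C N])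
    fix n k assume n: "n \<ge> N"
    define R where "R = ((real n + 1) / (real k + 1)) powr \<beta>"
    define r where "r = real k / real n"
    have Rr: "R \<ge> 0" "r \<ge> 0" by (simp_all add: R_def r_def)
    have an: "a n > 0" using pos n by simp
    consider "n \<le> k" | "N \<le> k" "k \<le> n" | "k < N" by linarith
    then have "a k \<le> C * R * a n \<or> a k \<le> C * r * a n"
    proof cases
      case 1
      have "a k \<le> C1 * r * a n"
        using N1[of n k] 1 n N by (simp add: r_def)
      also have "\<dots> \<le> C * r * a n" using C Rr an by (intro mult_right_mono) auto
      finally show ?thesis by simp
    next
      case 2
      have "a k \<le> C2 * (real n / real k) powr \<beta> * a n"
        using lower[of k n] 2 by simp
      also have "(real n / real k) powr \<beta> \<le> (2 * ((real n + 1) / (real k + 1))) powr \<beta>"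
      proof (rule powr_mono2)
        have "real n * 1 \<le> real n * real k" using 2 N by (intro mult_left_mono) auto
        then have "real n * (real k + 1) \<le> 2 * (real n + 1) * real k"
          by (simp add: algebra_simps)
        then show "real n / real k \<le> 2 * ((real n + 1) / (real k + 1))"
          using 2 N by (simp add: divide_simps mult_ac)
      qed (use \<beta>0 in auto)
      also have "\<dots> = 2 powr \<beta> * R" by (subst powr_mult) (auto simp: R_def)
      also have "\<dots> \<le> 2 * R" using \<beta>2 Rr by (intro mult_right_mono) auto
      finally have "a k \<le> (2 * C2) * R * a n" using C2 an by simp
      also have "\<dots> \<le> C * R * a n" using C Rr an by (intro mult_right_mono) auto
      finally show ?thesis by simp
    next
      case 3
      have "a k \<le> D * a N" using le[of k] pos[of N] by (simp add: D_def)
      also have "a N \<le> C2 * (real n / real N) powr \<beta> * a n"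
        using lower[of N n] n by simp
      also have "(real n / real N) powr \<beta> \<le> R"
        unfolding R_def using 3 N \<beta>0 by (intro powr_mono2 frac_le) auto
      finally have "a k \<le> (D * C2) * R * a n" using C2 D an by (simp add: mult_ac)
      also have "\<dots> \<le> C * R * a n" using C Rr an by (intro mult_right_mono) auto
      finally show ?thesis by simp
    qed
    moreover have "C * R * a n \<ge> 0" "C * r * a n \<ge> 0" using C Rr an by auto
    ultimately show "a k \<le> C * (((real n + 1) / (real k + 1)) powr \<beta> + real k / real n) * a n"
      unfolding R_def[symmetric] r_def[symmetric] by (auto simp: distrib_left distrib_right)
  qed (use C N pos in auto)
qed

section \<open>Karamata's Abelian theorem\<close>

lemma has_bochner_integral_Gamma:
  assumes "s > (0 :: real)"
  shows "has_bochner_integral lborel (\<lambda>x. indicator {0..} x * x powr (s - 1) / exp x) (Gamma s)"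
proof (rule has_bochner_integral_nn_integral)
  show "(\<integral>\<^sup>+x. ennreal (indicator {0..} x * x powr (s - 1) / exp x) \<partial>lborel) = ennreal (Gamma s)"
    by (rule Gamma_conv_nn_integral_real[OF assms, symmetric])
  show "0 \<le> Gamma s" using Gamma_real_pos[OF assms] by simp
qed auto

text \<open>With k = floor(n x), the quotient is the integral of (a_k/a_n) (1 - 1/n)^k over x \<ge>
  0. The integrand tends to x^(\<rho>-1) exp(-x), whose integral is Gamma(\<rho>).\<close>

lemma regularly_varying_seq_Abel:
  assumes rv: "regularly_varying_seq a (\<rho> - 1)" and nonneg: "\<And>n. a n \<ge> 0" and le: "\<And>n. a n \<le> A"
    and \<rho>: "0 < \<rho>" "\<rho> \<le> 1"
  shows "(\<lambda>n. (\<Sum>k. a k * (1 - 1 / real n) ^ k) / (real n * a n)) \<longlonglongrightarrow> Gamma \<rho>"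
proof -
  \<comment> \<open>Any value strictly between 1 - \<rho> and 1 would serve: the lower limit is for
    the Potter bound, the upper one makes x^(-\<beta>) integrable at 0.\<close>
  define \<beta> where "\<beta> = 1 - \<rho> / 2"
  have \<beta>: "0 < \<beta>" "\<beta> < 1" using \<rho> by (auto simp: \<beta>_def)
  obtain C N where C: "C > 0" and N: "N > 0" and pos: "\<And>n. n \<ge> N \<Longrightarrow> a n > 0"
    and dom: "\<And>n k. n \<ge> N \<Longrightarrow>
      a k \<le> C * (((real n + 1) / (real k + 1)) powr \<beta> + real k / real n) * a n"
    using regularly_varying_seq_dominated[OF rv nonneg le, of \<beta>] \<rho> \<beta> by (auto simp: \<beta>_def)
  define M where "M = max N 2"
  define c where "c n k = a k * (1 - 1 / real n) ^ k / a n" for n k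
  define s where "s n x = indicator {0..} x * c n (nat \<lfloor>real n * x\<rfloor>)" for n x
  \<comment> \<open>The majorant 2 C (x^(-\<beta>) + x) exp(1 - x), written as two Gamma integrands
    with parameters 1 - \<beta> and 2.\<close>
  define w where "w x = 2 * C * exp 1 * (indicator {0..} x * x powr ((1 - \<beta>) - 1) / exp x +
      indicator {0..} x * x powr (2 - 1) / exp x)" for x :: real
  have A: "A > 0" using pos[of N] le[of N] by linarith
  have c_nonneg: "c n k \<ge> 0" if "n \<ge> M" for n k
    using that nonneg by (auto simp: c_def M_def intro!: divide_nonneg_nonneg mult_nonneg_nonneg)
  have c_sum: "summable (\<lambda>k. a k * (1 - 1 / real n) ^ k)" if "n \<ge> M" for n
  proof (rule summable_comparison_test')
    show "summable (\<lambda>k. A * (1 - 1 / real n) ^ k)"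
      using that by (intro summable_mult summable_geometric) (auto simp: M_def)
    show "norm (a k * (1 - 1 / real n) ^ k) \<le> A * (1 - 1 / real n) ^ k" for k
      using that le[of k] nonneg[of k] A by (auto simp: M_def norm_mult intro!: mult_right_mono)
  qed
  have s_int: "has_bochner_integral lborel (s n)
      ((\<Sum>k. a k * (1 - 1 / real n) ^ k) / (real n * a n))" if "n \<ge> M" for n
  proof -
    have "c n sums ((\<Sum>k. a k * (1 - 1 / real n) ^ k) / a n)"
      unfolding c_def by (intro sums_divide summable_sums c_sum that)
    then have "summable (c n)" "suminf (c n) = (\<Sum>k. a k * (1 - 1 / real n) ^ k) / a n"
      by (simp_all add: sums_iff)
    then show ?thesis
      using has_bochner_integral_floor[of n "c n"] c_nonneg[OF that] that
      by (simp add: s_def[abs_def] M_def mult.commute)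
  qed
  \<comment> \<open>The null set x = 0 must be left out: \<open>0 powr y = 0\<close> makes
    \<open>w 0\<close> vanish, but \<open>s n 0\<close> is a_0/a_n.\<close>
  have s_le: "norm (s n x) \<le> w x" if n: "n \<ge> M" and x: "x \<noteq> 0" for n x
  proof (cases "x > 0")
    case True
    define k where "k = nat \<lfloor>real n * x\<rfloor>"
    have n2: "n \<ge> N" "n \<ge> 2" using n by (auto simp: M_def)
    have k: "real k \<le> real n * x" "real n * x < real k + 1"
      using nat_floor_bounds[of "real n * x"] True by (auto simp: k_def)
    have "a k \<le> C * (((real n + 1) / (real k + 1)) powr \<beta> + real k / real n) * a n"
      by (rule dom) fact
    then have "a k / a n \<le> C * (((real n + 1) / (real k + 1)) powr \<beta> + real k / real n)"
      using pos[OF n2(1)] by (simp add: pos_divide_le_eq)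
    also have "\<dots> \<le> C * (2 * x powr - \<beta> + x)"
    proof (intro mult_left_mono add_mono)
      have "((real n + 1) / (real k + 1)) powr \<beta> \<le> (2 / x) powr \<beta>"
      proof (rule powr_mono2)
        have "(real n + 1) / (real k + 1) \<le> (real n + real n) / (real n * x)"
          using n2 k True by (intro frac_le) auto
        then show "(real n + 1) / (real k + 1) \<le> 2 / x" using n2 by simp
      qed (use \<beta> in auto)
      also have "\<dots> = 2 powr \<beta> * x powr - \<beta>"
        using True by (simp add: powr_divide powr_minus field_simps)
      also have "2 powr \<beta> \<le> 2 powr 1" using \<beta> by (intro powr_mono) auto
      finally show "((real n + 1) / (real k + 1)) powr \<beta> \<le> 2 * x powr - \<beta>"
        by (simp add: mult_right_mono)
      show "real k / real n \<le> x" using k n2 by (simp add: field_simps)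
    qed (use C in auto)
    also have "\<dots> \<le> C * (2 * x powr - \<beta> + 2 * x)"
      using C True by (intro mult_left_mono) auto
    finally have 1: "a k / a n \<le> 2 * C * (x powr - \<beta> + x)" by (simp add: algebra_simps)
    have "(1 - 1 / real n) ^ k \<le> exp (- (1 / real n)) ^ k"
      using n2 exp_ge_add_one_self[of "- (1 / real n)"] by (intro power_mono) auto
    also have "\<dots> = exp (- (real k / real n))" by (simp flip: exp_of_nat_mult)
    also have "\<dots> \<le> exp (1 - x)"
    proof -
      have "real n * (x - 1) \<le> real k" using k n2 by (simp add: algebra_simps)
      then have "x - 1 \<le> real k / real n" using n2 by (simp add: field_simps)
      then show ?thesis by simp
    qed
    finally have 2: "(1 - 1 / real n) ^ k \<le> exp (1 - x)" .
    have "norm (s n x) = (a k / a n) * (1 - 1 / real n) ^ k"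
      using True c_nonneg[OF n, of k]
      unfolding s_def k_def[symmetric] real_norm_def by (simp add: c_def del: abs_divide)
    also have "\<dots> \<le> 2 * C * (x powr - \<beta> + x) * exp (1 - x)"
      using 1 2 C True n2 nonneg by (intro mult_mono) auto
    also have "\<dots> = w x"
      using True by (simp add: w_def exp_diff field_simps)
    finally show ?thesis .
  next
    case False
    then show ?thesis using x by (simp add: s_def w_def)
  qed
  have s_lim: "(\<lambda>n. s n x) \<longlonglongrightarrow> indicator {0..} x * x powr (\<rho> - 1) / exp x" if x: "x \<noteq> 0" for x
  proof (cases "x > 0")
    case True
    have l1: "(\<lambda>n. a (nat \<lfloor>real n * x\<rfloor>) / a n) \<longlonglongrightarrow> x powr (\<rho> - 1)"
      by (intro regularly_varying_seq_nat rv True)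
    have l2: "(\<lambda>n. real (nat \<lfloor>real n * x\<rfloor>) / real n) \<longlonglongrightarrow> x"
    proof (rule tendsto_sandwich)
      show "(\<lambda>n. x - 1 / real n) \<longlonglongrightarrow> x" by real_asymp
      show "(\<lambda>n. x) \<longlonglongrightarrow> x" by simp
      show "\<forall>\<^sub>F n in sequentially. x - 1 / real n \<le> real (nat \<lfloor>real n * x\<rfloor>) / real n"
        using eventually_gt_at_top[of 0]
      proof eventually_elim
        case (elim n)
        have "(real n * x - 1) / real n \<le> real (nat \<lfloor>real n * x\<rfloor>) / real n"
          using nat_floor_bounds[of "real n * x"] True by (intro divide_right_mono) auto
        then show ?case using elim by (simp add: diff_divide_distrib)
      qed
      show "\<forall>\<^sub>F n in sequentially. real (nat \<lfloor>real n * x\<rfloor>) / real n \<le> x"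
        using eventually_gt_at_top[of 0]
      proof eventually_elim
        case (elim n)
        have "real (nat \<lfloor>real n * x\<rfloor>) / real n \<le> real n * x / real n"
          using nat_floor_bounds[of "real n * x"] True by (intro divide_right_mono) auto
        then show ?case using elim by simp
      qed
    qed
    have l3: "(\<lambda>n. real n * ln (1 - 1 / real n)) \<longlonglongrightarrow> - 1" by real_asymp
    have l4: "(\<lambda>n. exp (real (nat \<lfloor>real n * x\<rfloor>) / real n * (real n * ln (1 - 1 / real n)))) \<longlonglongrightarrow>
        exp (x * - 1)"
      by (intro tendsto_exp tendsto_mult l2 l3)
    have e: "\<forall>\<^sub>F n in sequentially.
        exp (real (nat \<lfloor>real n * x\<rfloor>) / real n * (real n * ln (1 - 1 / real n))) =
        (1 - 1 / real n) ^ nat \<lfloor>real n * x\<rfloor>"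
      using eventually_gt_at_top[of 1]
    proof eventually_elim
      case (elim n)
      have "exp (real (nat \<lfloor>real n * x\<rfloor>) / real n * (real n * ln (1 - 1 / real n))) =
          exp (real (nat \<lfloor>real n * x\<rfloor>) * ln (1 - 1 / real n))"
        using elim by simp
      also have "\<dots> = exp (ln (1 - 1 / real n)) ^ nat \<lfloor>real n * x\<rfloor>"
        by (rule exp_of_nat_mult)
      also have "exp (ln (1 - 1 / real n)) = 1 - 1 / real n" using elim by simp
      finally show ?case .
    qed
    have "(\<lambda>n. a (nat \<lfloor>real n * x\<rfloor>) / a n * (1 - 1 / real n) ^ nat \<lfloor>real n * x\<rfloor>) \<longlonglongrightarrow>
        x powr (\<rho> - 1) * exp (x * - 1)"
      by (intro tendsto_mult l1 Lim_transform_eventually[OF l4 e])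
    then show ?thesis using True by (simp add: s_def c_def exp_minus field_simps)
  next
    case False
    then show ?thesis using x by (simp add: s_def)
  qed
  have ae: "AE x in lborel. x \<noteq> (0 :: real)" by (rule AE_lborel_singleton)
  have "(\<lambda>n. integral\<^sup>L lborel (s (n + M))) \<longlonglongrightarrow>
      (\<integral>x. indicator {0..} x * x powr (\<rho> - 1) / exp x \<partial>lborel)"
  proof (rule integral_dominated_convergence[where w = w])
    show "(\<lambda>x::real. indicator {0..} x * x powr (\<rho> - 1) / exp x) \<in> borel_measurable lborel"
      by auto
    show "s (n + M) \<in> borel_measurable lborel" for n
      using s_int[of "n + M"] by (auto simp: has_bochner_integral_iff)
    show "integrable lborel w"
      unfolding w_def using \<beta>
      by (intro integrable_mult_right Bochner_Integration.integrable_add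
          integrable.intros[OF has_bochner_integral_Gamma]) auto
    show "AE x in lborel. (\<lambda>n. s (n + M) x) \<longlonglongrightarrow> indicator {0..} x * x powr (\<rho> - 1) / exp x"
      using ae by eventually_elim (intro LIMSEQ_ignore_initial_segment s_lim)
    show "AE x in lborel. norm (s (n + M) x) \<le> w x" for n
      using ae by eventually_elim (intro s_le, auto)
  qed
  also have "(\<integral>x. indicator {0..} x * x powr (\<rho> - 1) / exp x \<partial>lborel) = Gamma \<rho>"
    by (intro has_bochner_integral_integral_eq has_bochner_integral_Gamma \<rho>)
  finally have "(\<lambda>n. (\<Sum>k. a k * (1 - 1 / real (n + M)) ^ k) / (real (n + M) * a (n + M)))
      \<longlonglongrightarrow> Gamma \<rho>"
    using has_bochner_integral_integral_eq[OF s_int] by simp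
  then show ?thesis by (rule LIMSEQ_offset)
qed

subsection \<open>Asymptotics\<close>

lemma fps_conv_radius_ge_1_bounded:
  fixes F :: "real fps"
  assumes "\<And>n. \<bar>fps_nth F n\<bar> \<le> A"
  shows "fps_conv_radius F \<ge> 1"
  unfolding fps_conv_radius_def
proof (rule conv_radius_geI_ex')
  fix r :: real assume r: "0 < r" "ereal r < 1"
  then have "summable (\<lambda>n. A * r ^ n)"
    by (intro summable_mult summable_geometric) auto
  then show "summable (\<lambda>n. fps_nth F n * of_real r ^ n)"
    by (rule summable_comparison_test') (use r assms in \<open>auto simp: abs_mult intro!: mult_right_mono\<close>)
qed

text \<open>These are the renewal probabilities of the step law \<phi>. By u_n = sum of \<phi>_i
  u_(n-i), each is inductively at most the sum of the \<phi>_i.\<close>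

lemma renewal_sequence_bounds:
  fixes \<phi> :: "real fps"
  assumes phi0: "fps_nth \<phi> 0 = 0" and nonneg: "\<And>i. fps_nth \<phi> i \<ge> 0" and sums: "fps_nth \<phi> sums 1"
  shows "0 \<le> fps_nth (inverse (1 - \<phi>)) n \<and> fps_nth (inverse (1 - \<phi>)) n \<le> 1"
proof (induction n rule: less_induct)
  case (less n)
  define u where "u = inverse (1 - \<phi>)"
  have "(1 - \<phi>) * u = 1" unfolding u_def by (rule inverse_mult_eq_1') (simp add: phi0)
  then have u: "u = 1 + \<phi> * u" by (simp add: algebra_simps)
  show ?case
  proof (cases "n = 0")
    case True
    then show ?thesis by (simp add: phi0)
  next
    case False
    have "fps_nth u n = fps_nth (1 + \<phi> * u) n" using u by simp
    also have "\<dots> = (\<Sum>i\<le>n. fps_nth \<phi> i * fps_nth u (n - i))"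
      using False by (simp add: fps_mult_nth atLeast0AtMost)
    finally have un: "fps_nth u n = (\<Sum>i\<le>n. fps_nth \<phi> i * fps_nth u (n - i))" .
    have IH: "0 \<le> fps_nth \<phi> i * fps_nth u (n - i) \<and> fps_nth \<phi> i * fps_nth u (n - i) \<le> fps_nth \<phi> i"
      if "i \<le> n" for i
    proof (cases "i = 0")
      case True
      then show ?thesis by (simp add: phi0)
    next
      case False
      then have "0 \<le> fps_nth u (n - i) \<and> fps_nth u (n - i) \<le> 1"
        using less[of "n - i"] that by (simp add: u_def)
      then show ?thesis using nonneg[of i] by (simp add: mult_left_le)
    qed
    have "fps_nth u n \<le> (\<Sum>i\<le>n. fps_nth \<phi> i)"
      unfolding un using IH by (intro sum_mono) auto
    also have "\<dots> \<le> 1"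
      using sum_le_suminf[of "fps_nth \<phi>" "{..n}"] sums nonneg by (simp add: sums_iff)
    finally show ?thesis using IH un by (auto simp: u_def intro!: sum_nonneg)
  qed
qed

text \<open>A discrete Gronwall inequality: the product of all 1 + c q^i is at most exp(c / (1 -
  q)), so growth is at most linear, and absent if d = 0.\<close>

lemma geometric_perturbation_bound:
  fixes x :: "nat \<Rightarrow> real"
  assumes q: "0 < q" "q < 1" and c: "c \<ge> 0" and d: "d \<ge> 0" and x0: "x 0 \<ge> 0"
    and step: "\<And>n. x (Suc n) \<le> (1 + c * q ^ n) * x n + d"
  shows "x n \<le> exp (c / (1 - q)) * (x 0 + real n * d)"
proof -
  define e where "e n = (\<Prod>i<n. 1 + c * q ^ i)" for n
  have e1: "e n \<ge> 1" for n
    unfolding e_def using q c by (intro prod_ge_1) auto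
  have "x n \<le> e n * (x 0 + real n * d)"
  proof (induction n)
    case (Suc n)
    have "x (Suc n) \<le> (1 + c * q ^ n) * x n + d" by (rule step)
    also have "\<dots> \<le> (1 + c * q ^ n) * (e n * (x 0 + real n * d)) + e (Suc n) * d"
      using Suc q c d e1[of "Suc n"] by (intro add_mono mult_left_mono) (auto simp: mult_le_cancel_right1)
    also have "\<dots> = e (Suc n) * (x 0 + real (Suc n) * d)"
      by (simp add: e_def algebra_simps)
    finally show ?case .
  qed (simp add: e_def)
  also have "e n \<le> exp (c / (1 - q))"
  proof -
    have "e n \<le> (\<Prod>i<n. exp (c * q ^ i))"
      unfolding e_def using q c by (intro prod_mono) (auto simp: add_nonneg_nonneg)
    also have "\<dots> = exp (\<Sum>i<n. c * q ^ i)" by (simp add: exp_sum)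
    also have "(\<Sum>i<n. c * q ^ i) \<le> (\<Sum>i. c * q ^ i)"
      using q c by (intro sum_le_suminf summable_mult summable_geometric) auto
    also have "\<dots> = c / (1 - q)"
      using q by (simp add: suminf_mult suminf_geometric)
    finally show ?thesis by simp
  qed
  finally show ?thesis using x0 d by (simp add: mult_right_mono)
qed

text \<open>Since the u_n lie in [0, 1], W(z) = W(qz)/F(z) bounds w_n by a multiple of the partial
  sum \<open>v n\<close> of W(q). This makes \<open>v\<close> satisfy a Gronwall recursion with d =
  0.\<close>

lemma qfix_bounded:
  fixes F W :: "real fps"
  assumes q: "0 < q" "q < 1" and F0: "fps_nth F 0 = 1"
    and u: "\<And>n. 0 \<le> fps_nth (inverse F) n" "\<And>n. fps_nth (inverse F) n \<le> 1"
    and W0: "fps_nth W 0 = 1" and FW: "F * W = fps_dilate q W"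
  obtains K where "\<And>n. 0 \<le> fps_nth W n \<and> fps_nth W n \<le> K"
proof -
  have "inverse F * F = 1" using F0 by (intro inverse_mult_eq_1) simp
  then have "W = inverse F * (F * W)" by (simp flip: mult.assoc)
  then have W: "W = inverse F * fps_dilate q W" by (simp only: FW)
  define v where "v n = (\<Sum>m<n. q ^ m * fps_nth W m)" for n
  have Wn: "(1 - q ^ n) * fps_nth W n = (\<Sum>m<n. fps_nth (inverse F) (n - m) * (q ^ m * fps_nth W m))" for n
  proof -
    have "fps_nth W n = fps_nth (fps_dilate q W * inverse F) n"
      by (subst W) (simp only: mult.commute)
    also have "\<dots> = (\<Sum>m<n. fps_nth (inverse F) (n - m) * (q ^ m * fps_nth W m)) + q ^ n * fps_nth W n"
      unfolding fps_mult_nth atLeast0AtMost lessThan_Suc_atMost[symmetric] sum.lessThan_Suc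
      using F0 by (simp add: mult_ac)
    finally show ?thesis by (simp add: algebra_simps)
  qed
  have q1: "q ^ n \<le> q" "1 - q ^ n > 0" if "n \<ge> 1" for n
  proof -
    show "q ^ n \<le> q" using power_decreasing[OF that, of q] q by simp
    then show "1 - q ^ n > 0" using q by linarith
  qed
  have nonneg: "0 \<le> fps_nth W n" for n
  proof (induction n rule: less_induct)
    case (less n)
    show ?case
    proof (cases "n = 0")
      case False
      have "0 \<le> (1 - q ^ n) * fps_nth W n"
        unfolding Wn using less u q by (intro sum_nonneg mult_nonneg_nonneg) auto
      then show ?thesis using q1[of n] False by (simp add: zero_le_mult_iff)
    qed (simp add: W0)
  qed
  have W_le: "fps_nth W n \<le> v n / (1 - q)" if "n \<ge> 1" for n
  proof -
    have "(1 - q) * fps_nth W n \<le> (1 - q ^ n) * fps_nth W n"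
      using q1[OF that] nonneg by (intro mult_right_mono) auto
    also have "\<dots> \<le> (\<Sum>m<n. 1 * (q ^ m * fps_nth W m))"
      unfolding Wn using nonneg q u by (intro sum_mono mult_right_mono) auto
    finally show ?thesis using q by (simp add: v_def field_simps)
  qed
  define E where "E = exp (1 / (1 - q) / (1 - q))"
  \<comment> \<open>The recursion starts at \<open>v (Suc 0) = 1\<close>, because
    \<open>W_le\<close> fails at 0, where \<open>v 0\<close> is an empty sum.\<close>
  have v_le: "v (Suc n) \<le> E" for n
  proof -
    have "v (Suc n) \<le> exp (1 / (1 - q) / (1 - q)) * (v (Suc 0) + real n * 0)"
    proof (rule geometric_perturbation_bound[OF q, where x = "\<lambda>n. v (Suc n)"])
      fix n
      have v0: "v (Suc n) \<ge> 0" unfolding v_def using nonneg q by (intro sum_nonneg) auto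
      have "v (Suc (Suc n)) = v (Suc n) + q ^ Suc n * fps_nth W (Suc n)" by (simp add: v_def)
      also have "\<dots> \<le> v (Suc n) + q ^ n * (v (Suc n) / (1 - q))"
        using W_le[of "Suc n"] nonneg q v0
        by (intro add_mono mult_mono power_decreasing) auto
      finally show "v (Suc (Suc n)) \<le> (1 + 1 / (1 - q) * q ^ n) * v (Suc n) + 0"
        by (simp add: algebra_simps)
    qed (use q in \<open>auto simp: v_def W0\<close>)
    then show ?thesis by (simp add: E_def v_def W0)
  qed
  have "fps_nth W n \<le> max 1 (E / (1 - q))" for n
  proof (cases n)
    case (Suc m)
    have "fps_nth W n \<le> v n / (1 - q)" using Suc by (intro W_le) simp
    also have "\<dots> \<le> E / (1 - q)" using v_le[of m] Suc q by (intro divide_right_mono) auto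
    finally show ?thesis by simp
  qed (simp add: W0)
  then show ?thesis using nonneg by (intro that) auto
qed

text \<open>The source of the common factor q^n: the exponent (k+1)(n-k) is smallest at k = 0 and k
  = n - 1, where it equals n.\<close>

lemma Suc_mult_diff_ge: "k < n \<Longrightarrow> n \<le> Suc k * (n - k)"
proof -
  assume "k < n"
  then have "k * 1 \<le> k * (n - k)" by (intro mult_le_mono) auto
  then show ?thesis using \<open>k < n\<close> unfolding mult_Suc by linarith
qed

text \<open>Tannery's theorem yields w_n/u_n -> W(q). The error (t_n - w_n)/u_n is at most q^n times
  a linear bound for the sum of the |t_k| times a linear bound for 1/u_n.\<close>

lemma qcoef_asymptotics:
  fixes F W :: "real fps"
  assumes q: "0 < q" "q < 1" and F0: "fps_nth F 0 = 1"
    and u: "\<And>n. 0 \<le> fps_nth (inverse F) n" "\<And>n. fps_nth (inverse F) n \<le> 1"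
    and rv: "regularly_varying_seq (fps_nth (inverse F)) (\<rho> - 1)" and \<rho>: "0 < \<rho>" "\<rho> \<le> 1"
    and W0: "fps_nth W 0 = 1" and FW: "F * W = fps_dilate q W"
    and WK: "\<And>n. 0 \<le> fps_nth W n \<and> fps_nth W n \<le> K"
  shows "(\<lambda>n. qcoef F q n / fps_nth (inverse F) n) \<longlonglongrightarrow> eval_fps W q"
proof -
  define a where "a = fps_nth (inverse F)"
  define w where "w = fps_nth W"
  define t where "t = qcoef F q"
  have K: "K > 0" using WK[of 0] W0 by linarith
  obtain C N where C: "C > 0" and N: "N > 0" and pos: "\<And>n. n \<ge> N \<Longrightarrow> a n > 0"
    and dom: "\<And>n k. n \<ge> N \<Longrightarrow>
      a k \<le> C * (((real n + 1) / (real k + 1)) powr (1 - \<rho> / 2) + real k / real n) * a n"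
    using regularly_varying_seq_dominated[OF rv u, of "1 - \<rho> / 2"] \<rho> by (auto simp: a_def)
  \<comment> \<open>Linear growth in the lag n - k is harmless against q^(n-k). At k = 0 this is the
    lower bound for \<open>a n\<close>, as \<open>a 0 = 1\<close>.\<close>
  have dom': "a k / a n \<le> C * (real (n - k) + 2)" if "n \<ge> N" "k \<le> n" for n k
  proof -
    have "((real n + 1) / (real k + 1)) powr (1 - \<rho> / 2) \<le> ((real n + 1) / (real k + 1)) powr 1"
      using \<rho> that by (intro powr_mono) auto
    also have "\<dots> \<le> real (n - k) + 1"
    proof -
      have "(real n - real k) * real k \<ge> 0" using that by simp
      then have "real n + 1 \<le> (real n - real k + 1) * (real k + 1)" by (simp add: algebra_simps)
      then show ?thesis using that by (simp add: pos_divide_le_eq of_nat_diff)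
    qed
    finally have 1: "((real n + 1) / (real k + 1)) powr (1 - \<rho> / 2) \<le> real (n - k) + 1" .
    have 2: "real k / real n \<le> 1" using that N by simp
    have "a k \<le> C * (((real n + 1) / (real k + 1)) powr (1 - \<rho> / 2) + real k / real n) * a n"
      using dom that by simp
    also have "\<dots> \<le> C * (real (n - k) + 2) * a n"
      using 1 2 C pos[OF that(1)] by (intro mult_right_mono mult_left_mono) auto
    finally show ?thesis using pos[OF that(1)] by (simp add: pos_divide_le_eq)
  qed
  have a0: "a 0 = 1" using F0 by (simp add: a_def)
  have W: "W = fps_dilate q W * inverse F"
  proof -
    have "F * inverse F = 1" using F0 by (intro inverse_mult_eq_1') simp
    then have "W = (F * inverse F) * W" by simp
    also have "\<dots> = F * W * inverse F" by (simp only: mult_ac)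
    finally show ?thesis by (simp only: FW)
  qed
  have w_sum: "w n = (\<Sum>m\<le>n. q ^ m * w m * a (n - m))" for n
    unfolding w_def a_def by (subst W) (simp add: fps_mult_nth atLeast0AtMost)

  \<comment> \<open>Extended by 0 to m > n, so that the sums over m \<le> n become series over one
    fixed range.\<close>
  define h where "h m n = (if m \<le> n then q ^ m * w m * (a (n - m) / a n) else 0)" for m n
  have h_lim: "(\<lambda>n. h m n) \<longlonglongrightarrow> w m * q ^ m" for m
  proof -
    have "(\<lambda>n. q ^ m * w m * (a (n - m) / a n)) \<longlonglongrightarrow> q ^ m * w m * 1"
      unfolding a_def by (intro tendsto_mult tendsto_const regularly_varying_seq_shift[OF rv])
    moreover have "\<forall>\<^sub>F n in sequentially. q ^ m * w m * (a (n - m) / a n) = h m n"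
      using eventually_ge_at_top[of m] by eventually_elim (simp add: h_def)
    ultimately show ?thesis using Lim_transform_eventually by (simp add: mult_ac) fastforce
  qed
  have h_le: "norm (h m n) \<le> K * C * ((real m + 2) * q ^ m)" if "n \<ge> N" for m n
  proof (cases "m \<le> n")
    case True
    have "norm (h m n) = q ^ m * w m * (a (n - m) / a n)"
      using True WK[of m] q u(1) pos[OF that]
      by (auto simp: h_def w_def a_def intro!: abs_of_nonneg mult_nonneg_nonneg divide_nonneg_nonneg)
    also have "\<dots> \<le> q ^ m * K * (C * (real m + 2))"
      using True WK[of m] q u(1) K pos[OF that] dom'[OF that, of "n - m"]
      by (intro mult_mono) (auto simp: w_def a_def intro!: divide_nonneg_nonneg)
    finally show ?thesis by (simp add: mult_ac)
  next
    case False
    then show ?thesis using K C q by (simp add: h_def)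
  qed
  have summ: "summable (\<lambda>m. K * C * ((real m + 2) * q ^ m))"
  proof -
    have "summable (\<lambda>m. real (Suc m) * q ^ m + q ^ m)"
      using q by (intro summable_add summable_geometric sums_summable[OF geometric_deriv_sums]) auto
    moreover have "real (Suc m) * q ^ m + q ^ m = (real m + 2) * q ^ m" for m
      by (simp add: algebra_simps)
    ultimately show ?thesis by (intro summable_mult) simp
  qed
  have ev: "\<forall>\<^sub>F (m, n) in at_top \<times>\<^sub>F at_top. norm (h m n) \<le> K * C * ((real m + 2) * q ^ m)"
    unfolding eventually_prod_filter
    using h_le by (intro exI[of _ "\<lambda>_. True"] exI[of _ "\<lambda>n. n \<ge> N"]) auto
  have "(\<lambda>n. \<Sum>m. h m n) \<longlonglongrightarrow> (\<Sum>m. w m * q ^ m)"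
    using tannerys_theorem[OF h_lim ev summ] by simp
  moreover have "(\<Sum>m. h m n) = w n / a n" for n
  proof -
    have "(\<lambda>m. h m n) sums (\<Sum>m\<le>n. h m n)"
      by (rule sums_finite) (auto simp: h_def)
    moreover have "(\<Sum>m\<le>n. h m n) = w n / a n"
      unfolding w_sum[of n] sum_divide_distrib by (intro sum.cong) (auto simp: h_def)
    ultimately show ?thesis by (simp add: sums_iff)
  qed
  ultimately have lim_w: "(\<lambda>n. w n / a n) \<longlonglongrightarrow> eval_fps W q"
    by (simp add: eval_fps_def w_def)

  \<comment> \<open>\<open>tw\<close> bounds t_n through the earlier |t_k| only, which is a Gronwall
    recursion for their partial sums.\<close>
  define s where "s n = (\<Sum>k<n. \<bar>t k\<bar>)" for n
  have tw: "\<bar>t n - w n\<bar> \<le> q ^ n * K * s n" for n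
  proof -
    have "w n = (\<Sum>k<n. t k * q ^ (Suc k * (n - k)) * w (n - k)) + t n"
      using qcoef_fixed_sum[OF F0 FW, of n] W0
      by (simp add: t_def w_def lessThan_Suc_atMost[symmetric] del: mult_Suc)
    then have "\<bar>t n - w n\<bar> = \<bar>\<Sum>k<n. t k * q ^ (Suc k * (n - k)) * w (n - k)\<bar>"
      by (simp add: abs_minus_commute)
    also have "\<dots> \<le> (\<Sum>k<n. \<bar>t k * q ^ (Suc k * (n - k)) * w (n - k)\<bar>)"
      by (rule sum_abs)
    also have "\<dots> \<le> (\<Sum>k<n. \<bar>t k\<bar> * q ^ n * K)"
    proof (intro sum_mono)
      fix k assume "k \<in> {..<n}"
      then have "q ^ (Suc k * (n - k)) \<le> q ^ n"
        using q by (intro power_decreasing Suc_mult_diff_ge) auto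
      then show "\<bar>t k * q ^ (Suc k * (n - k)) * w (n - k)\<bar> \<le> \<bar>t k\<bar> * q ^ n * K"
        using q K WK[of "n - k"] by (auto simp: abs_mult w_def intro!: mult_mono)
    qed
    also have "\<dots> = q ^ n * K * s n"
      by (simp add: s_def sum_distrib_left mult_ac)
    finally show ?thesis .
  qed
  define E where "E = exp (K / (1 - q))"
  have s_le: "s n \<le> E * (s 0 + real n * K)" for n
    unfolding E_def
  proof (rule geometric_perturbation_bound[OF q])
    fix n
    have "\<bar>t n\<bar> \<le> \<bar>w n\<bar> + \<bar>t n - w n\<bar>" by linarith
    also have "\<dots> \<le> K + q ^ n * K * s n"
      using tw[of n] WK[of n] by (intro add_mono) (auto simp: w_def)
    finally show "s (Suc n) \<le> (1 + K * q ^ n) * s n + K"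
      by (simp add: s_def algebra_simps)
  qed (use K in \<open>auto simp: s_def\<close>)
  have lim_tw: "(\<lambda>n. (t n - w n) / a n) \<longlonglongrightarrow> 0"
  proof (rule Lim_null_comparison)
    show "\<forall>\<^sub>F n in sequentially. norm ((t n - w n) / a n) \<le>
        q ^ n * K * (E * (real n * K)) * (C * (real n + 2))"
      using eventually_ge_at_top[of N]
    proof eventually_elim
      case (elim n)
      have "norm ((t n - w n) / a n) = \<bar>t n - w n\<bar> * (a 0 / a n)"
        using pos[OF elim] by (simp add: a0)
      also have "\<dots> \<le> (q ^ n * K * (E * (real n * K))) * (C * (real (n - 0) + 2))"
      proof (rule mult_mono)
        have "q ^ n * K * s n \<le> q ^ n * K * (E * (real n * K))"
          using s_le[of n] q K by (intro mult_left_mono) (auto simp: s_def)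
        then show "\<bar>t n - w n\<bar> \<le> q ^ n * K * (E * (real n * K))"
          using tw[of n] by linarith
      qed (use dom'[OF elim, of 0] q K a0 pos[OF elim] in \<open>auto simp: E_def\<close>)
      finally show ?case by simp
    qed
    show "(\<lambda>n. q ^ n * K * (E * (real n * K)) * (C * (real n + 2))) \<longlonglongrightarrow> 0"
    proof -
      have "(\<lambda>n. q ^ n * real n * (real n + 2)) \<longlonglongrightarrow> 0"
        using q by real_asymp
      then have "(\<lambda>n. K * E * K * C * (q ^ n * real n * (real n + 2))) \<longlonglongrightarrow> K * E * K * C * 0"
        by (intro tendsto_intros)
      then show ?thesis by (simp add: mult_ac)
    qed
  qed
  have "(\<lambda>n. w n / a n + (t n - w n) / a n) \<longlonglongrightarrow> eval_fps W q + 0"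
    by (intro tendsto_add lim_w lim_tw)
  then show ?thesis by (simp add: t_def a_def add_divide_distrib[symmetric])
qed

section \<open>The coefficientwise limit for an indeterminate q\<close>

lemma fps_const_lift_mult:
  "Abs_fps (\<lambda>n. fps_const (fps_nth (F * G) n)) =
    Abs_fps (\<lambda>n. fps_const (fps_nth F n)) * Abs_fps (\<lambda>n. fps_const (fps_nth (G :: 'a::comm_ring_1 fps) n))"
proof (rule fps_ext)
  have sum: "fps_const (sum f A) = (\<Sum>x\<in>A. fps_const (f x :: 'a))" for f and A :: "nat set"
    by (induction A rule: infinite_finite_induct) (simp_all flip: fps_const_add)
  show "fps_nth (Abs_fps (\<lambda>n. fps_const (fps_nth (F * G) n))) n =
    fps_nth (Abs_fps (\<lambda>n. fps_const (fps_nth F n)) * Abs_fps (\<lambda>n. fps_const (fps_nth G n))) n" for n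
    by (simp add: fps_mult_nth sum)
qed

text \<open>For fixed j everything becomes finite: once n > j, the factor q^n removes all terms with
  k < n, so t_n and w_n have the same coefficient at q^j, and only m \<le> j contribute to
  it.\<close>

lemma formal_qcoef_asymptotics:
  fixes \<phi> :: "real fps"
  defines "F \<equiv> Abs_fps (\<lambda>m. fps_const (fps_nth (1 - \<phi>) m))"
  assumes phi0: "fps_nth \<phi> 0 = 0"
    and rv: "regularly_varying_seq (fps_nth (inverse (1 - \<phi>))) \<alpha>"
  shows "(\<lambda>n. fps_nth (qcoef F fps_X n) j / fps_nth (inverse (1 - \<phi>)) n) \<longlonglongrightarrow> fps_nth (L_fps \<phi>) j"
proof -
  define a where "a = fps_nth (inverse (1 - \<phi>))"
  define U where "U = Abs_fps (\<lambda>m. fps_const (a m))"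
  have F0: "fps_nth F 0 = 1" by (simp add: F_def phi0)
  obtain W where W0: "fps_nth W 0 = 1" and W: "F * W = fps_dilate fps_X W"
  proof (rule qfix_exists[OF F0])
    fix n :: nat assume "n \<ge> 1"
    then have "fps_nth (1 - fps_X ^ n :: real fps) 0 \<noteq> 0" by simp
    then show "\<exists>v. v * (1 - fps_X ^ n) = (1 :: real fps)"
      by (metis inverse_mult_eq_1)
  qed
  have FU: "F * U = 1"
  proof -
    have "F * U = Abs_fps (\<lambda>n. fps_const (fps_nth ((1 - \<phi>) * inverse (1 - \<phi>)) n))"
      unfolding F_def U_def a_def by (rule fps_const_lift_mult[symmetric])
    also have "(1 - \<phi>) * inverse (1 - \<phi>) = 1" by (rule inverse_mult_eq_1') (simp add: phi0)
    finally show ?thesis by (simp add: fps_eq_iff)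
  qed
  have WU: "W = fps_dilate fps_X W * U"
  proof -
    have "W = (F * U) * W" by (simp add: FU)
    also have "\<dots> = F * W * U" by (simp only: mult_ac)
    finally show ?thesis by (simp only: W)
  qed
  have W_coeff: "fps_nth (fps_nth W n) j = (\<Sum>m\<le>j. fps_nth (fps_nth W m * fps_X ^ m) j * a (n - m))"
    if "n \<ge> j" for n
  proof -
    have "fps_nth W n = (\<Sum>m\<le>n. fps_const (a (n - m)) * (fps_nth W m * fps_X ^ m))"
      by (subst WU) (simp add: fps_mult_nth atLeast0AtMost U_def mult_ac)
    then have "fps_nth (fps_nth W n) j = (\<Sum>m\<le>n. fps_nth (fps_nth W m * fps_X ^ m) j * a (n - m))"
      by (simp add: fps_sum_nth mult.commute)
    also have "\<dots> = (\<Sum>m\<le>j. fps_nth (fps_nth W m * fps_X ^ m) j * a (n - m))"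
      using that by (intro sum.mono_neutral_right) (auto simp: fps_X_power_mult_right_nth)
    finally show ?thesis .
  qed
  have t_coeff: "fps_nth (qcoef F fps_X n) j = fps_nth (fps_nth W n) j" if "n > j" for n
  proof -
    have "fps_nth W n = (\<Sum>k<n. qcoef F fps_X k * fps_X ^ (Suc k * (n - k)) * fps_nth W (n - k)) +
        qcoef F fps_X n"
      using qcoef_fixed_sum[OF F0 W, of n] W0
      by (simp add: lessThan_Suc_atMost[symmetric] del: mult_Suc)
    moreover have "fps_nth (qcoef F fps_X k * fps_X ^ (Suc k * (n - k)) * fps_nth W (n - k)) j = 0"
      if "k < n" for k
    proof -
      have "j < Suc k * (n - k)" using Suc_mult_diff_ge[OF \<open>k < n\<close>] \<open>n > j\<close> by linarith
      then show ?thesis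
        unfolding mult.assoc mult.left_commute[of "qcoef F fps_X k"]
        by (simp only: fps_X_power_mult_nth if_True)
    qed
    ultimately show ?thesis by (simp add: fps_sum_nth del: mult_Suc)
  qed
  have "(\<lambda>n. \<Sum>m\<le>j. fps_nth (fps_nth W m * fps_X ^ m) j * (a (n - m) / a n)) \<longlonglongrightarrow>
      (\<Sum>m\<le>j. fps_nth (fps_nth W m * fps_X ^ m) j * 1)"
    unfolding a_def by (intro tendsto_sum tendsto_mult tendsto_const regularly_varying_seq_shift[OF rv])
  moreover have "(\<Sum>m\<le>j. fps_nth (fps_nth W m * fps_X ^ m) j * 1) = fps_nth (L_fps \<phi>) j"
    using L_fps_eq[OF W0 W[unfolded F_def] phi0] by (simp add: fps_subst_X_power_def)
  moreover have "\<forall>\<^sub>F n in sequentially.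
      (\<Sum>m\<le>j. fps_nth (fps_nth W m * fps_X ^ m) j * (a (n - m) / a n)) =
      fps_nth (qcoef F fps_X n) j / a n"
    using eventually_gt_at_top[of j]
    by eventually_elim (simp add: t_coeff W_coeff sum_divide_distrib)
  ultimately show ?thesis unfolding a_def[symmetric] using Lim_transform_eventually by fastforce
qed

text \<open>For U = 1/(1 - \<phi>) and n > 1, \<Phi>_n is Gamma(\<rho>) / U(1 - 1/n), so the claim
  is the reciprocal of Karamata's limit.\<close>

lemma Phi_seq_asymptotics:
  fixes \<phi> :: "real fps"
  assumes phi0: "fps_nth \<phi> 0 = 0" and rad: "fps_conv_radius \<phi> \<ge> 1"
    and u: "\<And>n. 0 \<le> fps_nth (inverse (1 - \<phi>)) n" "\<And>n. fps_nth (inverse (1 - \<phi>)) n \<le> 1"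
    and rv: "regularly_varying_seq (fps_nth (inverse (1 - \<phi>))) (\<rho> - 1)" and \<rho>: "0 < \<rho>" "\<rho> \<le> 1"
  shows "(\<lambda>n. real n * Phi_seq \<phi> \<rho> n * fps_nth (inverse (1 - \<phi>)) n) \<longlonglongrightarrow> 1"
proof -
  define U where "U = inverse (1 - \<phi>)"
  have radU: "fps_conv_radius U \<ge> 1"
    by (rule fps_conv_radius_ge_1_bounded[of _ 1]) (use u in \<open>simp add: U_def\<close>)
  have rad1: "fps_conv_radius (1 - \<phi>) \<ge> 1"
    using fps_conv_radius_diff[of 1 \<phi>] rad by (auto intro: order_trans)
  have eval: "1 - eval_fps \<phi> x = inverse (eval_fps U x)" if "\<bar>x\<bar> < 1" for x
  proof -
    have x: "ereal (norm x) < 1" using that by simp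
    have "eval_fps (1 - \<phi>) x * eval_fps U x = eval_fps ((1 - \<phi>) * U) x"
      by (intro eval_fps_mult[symmetric] less_le_trans[OF x] rad1 radU)
    also have "(1 - \<phi>) * U = 1" unfolding U_def by (rule inverse_mult_eq_1') (simp add: phi0)
    finally have "eval_fps (1 - \<phi>) x * eval_fps U x = 1" by simp
    moreover have "eval_fps (1 - \<phi>) x = 1 - eval_fps \<phi> x"
      using eval_fps_diff[OF _ less_le_trans[OF x rad], of 1] by simp
    ultimately show ?thesis by (metis inverse_unique mult.commute)
  qed
  have "(\<lambda>n. (\<Sum>k. fps_nth U k * (1 - 1 / real n) ^ k) / (real n * fps_nth U n)) \<longlonglongrightarrow> Gamma \<rho>"
    unfolding U_def by (rule regularly_varying_seq_Abel[OF rv u \<rho>])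
  then have "(\<lambda>n. Gamma \<rho> / (eval_fps U (1 - 1 / real n) / (real n * fps_nth U n))) \<longlonglongrightarrow> Gamma \<rho> / Gamma \<rho>"
    using Gamma_real_pos[OF \<rho>(1)] by (intro tendsto_divide tendsto_const) (auto simp: eval_fps_def)
  moreover have "\<forall>\<^sub>F n in sequentially.
      Gamma \<rho> / (eval_fps U (1 - 1 / real n) / (real n * fps_nth U n)) =
      real n * Phi_seq \<phi> \<rho> n * fps_nth U n"
    using eventually_gt_at_top[of 1]
  proof eventually_elim
    case (elim n)
    then have "\<bar>1 - 1 / real n\<bar> < 1" by simp
    from eval[OF this] show ?case by (simp add: Phi_seq_def divide_inverse)
  qed
  ultimately show ?thesis
    using Gamma_real_pos[OF \<rho>(1)] Lim_transform_eventually by (fastforce simp: U_def)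
qed

lemma tendsto_imp_density_zero:
  fixes x :: "nat \<Rightarrow> real"
  assumes "x \<longlonglongrightarrow> L" "\<delta> > 0"
  shows "(\<lambda>n. real (card {i \<in> {1..n}. \<bar>x i - L\<bar> \<ge> \<delta>}) / real n) \<longlonglongrightarrow> 0"
proof -
  obtain N where N: "\<And>i. i \<ge> N \<Longrightarrow> \<bar>x i - L\<bar> < \<delta>"
    using LIMSEQ_D[OF assms] by auto
  have "card {i \<in> {1..n}. \<bar>x i - L\<bar> \<ge> \<delta>} \<le> N" for n
  proof -
    have "{i \<in> {1..n}. \<bar>x i - L\<bar> \<ge> \<delta>} \<subseteq> {..<N}" using N by (force simp: not_less[symmetric])
    then show ?thesis by (metis card_lessThan card_mono finite_lessThan)
  qed
  then have "\<forall>\<^sub>F n in sequentially.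
      norm (real (card {i \<in> {1..n}. \<bar>x i - L\<bar> \<ge> \<delta>}) / real n) \<le> real N / real n"
    by (intro always_eventually allI) (simp add: divide_right_mono)
  then show ?thesis by (rule Lim_null_comparison) real_asymp
qed

lemma L_val_eq:
  fixes \<phi> W :: "real fps"
  assumes q: "0 < q" "q < 1" and rad: "fps_conv_radius \<phi> \<ge> 1" and radW: "fps_conv_radius W \<ge> 1"
    and W0: "fps_nth W 0 = 1" and FW: "(1 - \<phi>) * W = fps_dilate q W"
  shows "L_val \<phi> q = eval_fps W q"
proof -
  have rad1: "fps_conv_radius (1 - \<phi>) \<ge> 1"
    using fps_conv_radius_diff[of 1 \<phi>] rad by (auto intro: order_trans)
  have "1 - eval_fps \<phi> (q ^ Suc j) = eval_fps (1 - \<phi>) (q ^ Suc j)" for j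
  proof -
    have "norm (q ^ Suc j) < 1" using q by (simp add: power_Suc_less_one del: power_Suc)
    then have "ereal (norm (q ^ Suc j)) < fps_conv_radius \<phi>"
      using rad by (metis ereal_less(3) less_le_trans)
    then show ?thesis by (subst eval_fps_diff) auto
  qed
  then have "L_val \<phi> q = 1 / (\<Prod>j. eval_fps (1 - \<phi>) (q ^ Suc j))" unfolding L_val_def by presburger
  then show ?thesis using prodinf_eval_fps_fixed[OF q W0 FW rad1 radW] by simp
qed

text \<open>The witness \<open>T\<close> gives a meaning to [q^j] t_n, as \<open>t_seq\<close> is
  only a function of a number. Agreement on the interval (0, 1) determines each polynomial
  \<open>T n\<close>.\<close>

theorem theorem7p1:
  fixes \<phi> f :: "real fps" and g :: "real \<Rightarrow> real fps" and \<rho> q :: real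
  assumes q: "0 < q" "q < 1"
    and phi_0: "fps_nth \<phi> 0 = 0"
    and phi_nonneg: "\<And>i. i \<ge> 1 \<Longrightarrow> fps_nth \<phi> i \<ge> 0"
    and phi_min: "1 \<in> {x::real. x > 0 \<and> (\<lambda>n. fps_nth \<phi> n * x ^ n) sums 1}"
                 "\<And>y. y \<in> {x::real. x > 0 \<and> (\<lambda>n. fps_nth \<phi> n * x ^ n) sums 1} \<Longrightarrow> 1 \<le> y"
    and phi_ratio: "\<And>j. \<exists>l\<ge>0. (\<lambda>n. fps_nth \<phi> (j + n) / fps_nth \<phi> n) \<longlonglongrightarrow> l"
    and rho: "\<rho> - 1 \<in> {-1<..0}"
    and rv: "regularly_varying_seq (fps_nth (inverse (1 - \<phi>))) (\<rho> - 1)"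
    and f: "f = fps_X * (1 - \<phi>)"
    and g: "\<And>r. 0 < r \<Longrightarrow> r < 1 \<Longrightarrow> q_lagrange_inverse r f (g r)"
  shows "\<exists>T :: nat \<Rightarrow> real poly.
           (\<forall>n r. 0 < r \<and> r < 1 \<longrightarrow> poly (T n) r = t_seq g n r) \<and>
           liminf (\<lambda>n. ereal (real n * Phi_seq \<phi> \<rho> n * t_seq g n q)) = ereal (L_val \<phi> q) \<and>
           (\<forall>\<delta>>0. (\<lambda>n. real (card {i \<in> {1..n}.
                \<bar>real i * Phi_seq \<phi> \<rho> i * t_seq g i q - L_val \<phi> q\<bar> \<ge> \<delta>}) / real n) \<longlonglongrightarrow> 0) \<and>
           (\<forall>j. (\<lambda>n. real n * Phi_seq \<phi> \<rho> n * coeff (T n) j) \<longlonglongrightarrow> fps_nth (L_fps \<phi>) j)"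
proof -
  have nonneg: "fps_nth \<phi> i \<ge> 0" for i
    using phi_nonneg[of i] phi_0 by (cases "i = 0") auto
  have sums: "fps_nth \<phi> sums 1" using phi_min(1) by simp
  have \<rho>: "0 < \<rho>" "\<rho> \<le> 1" using rho by auto
  define F where "F = 1 - \<phi>"
  have F0: "fps_nth F 0 = 1" by (simp add: F_def phi_0)
  have u: "0 \<le> fps_nth (inverse F) n" "fps_nth (inverse F) n \<le> 1" for n
    using renewal_sequence_bounds[OF phi_0 nonneg sums, of n] by (auto simp: F_def)
  note rvF = rv[folded F_def]
  have rad: "fps_conv_radius \<phi> \<ge> 1"
  proof (rule fps_conv_radius_ge_1_bounded)
    fix n
    have "fps_nth \<phi> n = sum (fps_nth \<phi>) {n}" by simp
    also have "\<dots> \<le> suminf (fps_nth \<phi>)"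
      using sums nonneg by (intro sum_le_suminf) (auto simp: sums_iff)
    finally show "\<bar>fps_nth \<phi> n\<bar> \<le> 1" using nonneg sums by (simp add: sums_iff)
  qed
  have "\<exists>v. v * (1 - q ^ n) = 1" if "n \<ge> 1" for n
  proof -
    have "q ^ n \<le> q" using power_decreasing[OF that, of q] q by simp
    then have "1 - q ^ n \<noteq> 0" using q by linarith
    then show ?thesis by (intro exI[of _ "inverse (1 - q ^ n)"]) simp
  qed
  then obtain W where W0: "fps_nth W 0 = 1" and W: "F * W = fps_dilate q W"
    using qfix_exists[OF F0] by metis
  obtain K where K: "\<And>n. 0 \<le> fps_nth W n \<and> fps_nth W n \<le> K"
    using qfix_bounded[OF q F0 u W0 W] by metis
  have radW: "fps_conv_radius W \<ge> 1"
    by (rule fps_conv_radius_ge_1_bounded[of _ K]) (use K in simp)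

  have Phi: "(\<lambda>n. real n * Phi_seq \<phi> \<rho> n * fps_nth (inverse F) n) \<longlonglongrightarrow> 1"
    unfolding F_def by (rule Phi_seq_asymptotics[OF phi_0 rad u[unfolded F_def] rv \<rho>])
  \<comment> \<open>Reduces both limits to asymptotics relative to u_n.\<close>
  have Phi_mult: "(\<lambda>n. real n * Phi_seq \<phi> \<rho> n * x n) \<longlonglongrightarrow> l"
    if "(\<lambda>n. x n / fps_nth (inverse F) n) \<longlonglongrightarrow> l" for x l
  proof -
    have "(\<lambda>n. real n * Phi_seq \<phi> \<rho> n * fps_nth (inverse F) n * (x n / fps_nth (inverse F) n)) \<longlonglongrightarrow> 1 * l"
      by (intro tendsto_mult Phi that)
    moreover have "\<forall>\<^sub>F n in sequentially.
        real n * Phi_seq \<phi> \<rho> n * fps_nth (inverse F) n * (x n / fps_nth (inverse F) n) =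
        real n * Phi_seq \<phi> \<rho> n * x n"
      using regularly_varying_seq_nonzero[OF rvF] by eventually_elim simp
    ultimately show ?thesis using Lim_transform_eventually by fastforce
  qed

  \<comment> \<open>The same recursion with the polynomial variable for q. Evaluation at r maps it
    to \<open>t_seq\<close>, and \<open>fps_of_poly\<close> maps it to the formal version.\<close>
  define T where "T = qcoef (Abs_fps (\<lambda>m. [:fps_nth F m:])) [:0, 1:]"
  have T0: "fps_nth (Abs_fps (\<lambda>m. [:fps_nth F m:])) 0 = 1" by (simp add: F0 one_pCons)
  have t_eq: "t_seq g n r = qcoef F r n" if "0 < r" "r < 1" for n r
    using t_seq_eq_qcoef[OF _ F0, of r g n] g[OF that] that by (simp add: f F_def)
  have poly_T: "poly (T n) r = qcoef F r n" for n r
    unfolding T_def using qcoef_hom[OF T0, of "\<lambda>p. poly p r"] by (simp add: fps_nth_inverse)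
  have coeff_T: "coeff (T n) j =
      fps_nth (qcoef (Abs_fps (\<lambda>m. fps_const (fps_nth (1 - \<phi>) m))) fps_X n) j" for n j
  proof -
    have "fps_of_poly (T n) = qcoef (Abs_fps (\<lambda>m. fps_const (fps_nth F m))) fps_X n"
      unfolding T_def using qcoef_hom[OF T0, of fps_of_poly]
      by (simp add: fps_of_poly_add fps_of_poly_mult fps_of_poly_const fps_of_poly_pCons)
    then show ?thesis by (metis fps_of_poly_nth F_def)
  qed
  have lim: "(\<lambda>n. real n * Phi_seq \<phi> \<rho> n * t_seq g n q) \<longlonglongrightarrow> L_val \<phi> q"
    unfolding t_eq[OF q] L_val_eq[OF q rad radW W0 W[unfolded F_def]]
    by (intro Phi_mult qcoef_asymptotics[OF q F0 u rvF \<rho> W0 W K])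
  have "liminf (\<lambda>n. ereal (real n * Phi_seq \<phi> \<rho> n * t_seq g n q)) = ereal (L_val \<phi> q)"
    by (rule lim_imp_Liminf) (use lim in simp_all)
  moreover have "(\<lambda>n. real n * Phi_seq \<phi> \<rho> n * coeff (T n) j) \<longlonglongrightarrow> fps_nth (L_fps \<phi>) j" for j
    unfolding coeff_T
    by (rule Phi_mult) (unfold F_def, rule formal_qcoef_asymptotics[OF phi_0 rv])
  ultimately show ?thesis
    using t_eq poly_T tendsto_imp_density_zero[OF lim] by (intro exI[of _ T]) auto
qed

end
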